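(* Let $\gamma,g>0$ and let $(H_t,V_t)_{t\ge0}$ be the inert drift process with parameters $\gamma,g$ and state space $S=\mathbb{R}_+\times(-g/\gamma,\infty)$ (defined in the context). For each $(h,\nu)\in S$, $\mathbb{P}_{(h,\nu)}$-almost surely, $$\frac{1}{\sqrt2\sqrt{1+\gamma}}\le \limsup_{t\to\infty}\frac{V_t}{\sqrt{\log t}}\le 2\,\frac{1}{\sqrt{1+\gamma}},$$ $$\frac{\gamma}{2g}\le \limsup_{t\to\infty}\frac{H_t}{\log t}\le 16\,\frac{\gamma}{g}.$$
   Context: Fix $\gamma>0$ and $g>0$. Write $\mathbb{R}_+=[0,\infty)$ and $S=\mathbb{R}_+\times(-g/\gamma,\infty)$. Let $B$ be a one-dimensional standard Brownian motion with $B_0=0$. For $(h,\nu)\in S$, the inert drift process $(H_t,V_t)_{t\ge 0}$ is the continuous $S$-valued process that is the (pathwise unique, strong) solution of $$dH_t=V_t\,dt-dB_t+dL_t,\qquad dV_t=-(\gamma V_t+g)\,dt+dL_t,\qquad (H_0,V_0)=(h,\nu),$$ where $L$ is the unique continuous, non-negative, non-decreasing process such that $\int_0^t \mathbf 1_{\{H_u=0\}}\,dL_u=L_t$ and $H_t\ge 0$ for all $t\ge 0$. It has the representation $L_t=\sup_{u\le t}\left(-h+B_u-\int_0^u V_w\,dw\right)\vee 0$, and $(H,V)$ is a strong Markov process. $\mathbb{P}_{(h,\nu)}$ denotes probability when $(H_0,V_0)=(h,\nu)$. *)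

theory Defs
  imports "HOL-Probability.Probability"
begin

text \<open>
  Stochastic processes are functions \<open>real \<Rightarrow> 'a \<Rightarrow> real\<close> (time first); only their values at
  times \<open>t \<ge> 0\<close> are relevant.
\<close>

definition standard_brownian_motion :: "'a measure \<Rightarrow> (real \<Rightarrow> 'a \<Rightarrow> real) \<Rightarrow> bool" where
  "standard_brownian_motion M B \<longleftrightarrow>
     prob_space M \<and>
     (\<forall>t\<ge>0. B t \<in> borel_measurable M) \<and>
     (AE \<omega> in M. B 0 \<omega> = 0) \<and>
     (AE \<omega> in M. continuous_on {0..} (\<lambda>t. B t \<omega>)) \<and>
     (\<forall>s t. 0 \<le> s \<and> s < t \<longrightarrow>
        distributed M lborel (\<lambda>\<omega>. B t \<omega> - B s \<omega>) (normal_density 0 (sqrt (t - s)))) \<and>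
     (\<forall>(n::nat) (\<tau>::nat \<Rightarrow> real). 0 \<le> \<tau> 0 \<and> mono_on {..n} \<tau> \<longrightarrow>
        prob_space.indep_vars M (\<lambda>_. borel)
          (\<lambda>i \<omega>. B (\<tau> (Suc i)) \<omega> - B (\<tau> i) \<omega>) {..<n})"

definition inert_state_space :: "real \<Rightarrow> real \<Rightarrow> (real \<times> real) set" where
  "inert_state_space \<gamma> g = {0..} \<times> {- g / \<gamma> <..}"

text \<open>
  The pathwise content of the system of equations, in integrated form, for a driving path \<open>b\<close>.
  The Stieltjes integral against \<open>dL\<close> is the integral against \<^const>\<open>interval_measure\<close>, which
  needs an integrator on the whole real line: \<open>l\<close> is extended to negative times by the
  constant \<open>l 0\<close>, so that \<open>dL\<close> has no mass on \<open>{..0}\<close>.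
\<close>

definition inert_drift_path ::
  "real \<Rightarrow> real \<Rightarrow> real \<Rightarrow> real \<Rightarrow> (real \<Rightarrow> real) \<Rightarrow> (real \<Rightarrow> real) \<Rightarrow> (real \<Rightarrow> real) \<Rightarrow> (real \<Rightarrow> real) \<Rightarrow> bool"
where
  "inert_drift_path \<gamma> g h \<nu> b x v l \<longleftrightarrow>
     continuous_on {0..} x \<and> continuous_on {0..} v \<and> continuous_on {0..} l \<and>
     (\<forall>t\<ge>0. (x t, v t) \<in> inert_state_space \<gamma> g) \<and>
     (\<forall>t\<ge>0. 0 \<le> l t) \<and> mono_on {0..} l \<and>
     (\<forall>t\<ge>0. (LINT u:{0..t}|interval_measure (\<lambda>u. l (max 0 u)). indicator {u. x u = 0} u) = l t) \<and>
     (\<forall>t\<ge>0. x t = h + integral {0..t} v - b t + l t) \<and>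
     (\<forall>t\<ge>0. v t = \<nu> - integral {0..t} (\<lambda>u. \<gamma> * v u + g) + l t)"

text \<open>
  \<open>(H, V)\<close>, with boundary process \<open>L\<close>, is an inert drift process with parameters \<open>\<gamma>\<close> and \<open>g\<close>
  started from \<open>(h, \<nu>)\<close>, driven by \<open>B\<close>.  The initial condition follows from the integrated
  equations at time 0.  No adaptedness to the filtration of \<open>B\<close> is demanded: since the
  equations are pathwise unique, every process as below is indistinguishable from the strong
  solution.
\<close>

definition inert_drift_process ::
  "'a measure \<Rightarrow> real \<Rightarrow> real \<Rightarrow> real \<Rightarrow> real \<Rightarrow> (real \<Rightarrow> 'a \<Rightarrow> real) \<Rightarrow>
     (real \<Rightarrow> 'a \<Rightarrow> real) \<Rightarrow> (real \<Rightarrow> 'a \<Rightarrow> real) \<Rightarrow> (real \<Rightarrow> 'a \<Rightarrow> real) \<Rightarrow> bool"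
where
  "inert_drift_process M \<gamma> g h \<nu> B H V L \<longleftrightarrow>
     standard_brownian_motion M B \<and>
     (\<forall>t\<ge>0. H t \<in> borel_measurable M \<and> V t \<in> borel_measurable M \<and> L t \<in> borel_measurable M) \<and>
     (AE \<omega> in M. inert_drift_path \<gamma> g h \<nu>
        (\<lambda>t. B t \<omega>) (\<lambda>t. H t \<omega>) (\<lambda>t. V t \<omega>) (\<lambda>t. L t \<omega>))"

end

theory Submission
  imports Defs "HOL-Real_Asymp.Real_Asymp"
begin

text \<open>
  Write \<open>\<kappa> = 1 + \<gamma>\<close> and \<open>\<mu> = g / \<gamma>\<close>.  All four bounds compare the process with single increments of
  \<open>B\<close>, and only three features of Brownian motion enter: Gaussian tails of increments, independence
  of increments over disjoint intervals, and continuity.  Time is cut into the windows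
  \<open>[2\<^sup>j, 2\<^sup>j\<^sup>+\<^sup>1]\<close>, in which \<open>ln t\<close> is \<open>j ln 2\<close> up to a bounded error.

  Two facts about a single path carry the argument.  First, \<open>V - H\<close> does not see the boundary term:
  \<open>d(V - H) = dB - (\<kappa> V + g) dt\<close>.  Second, away from the zeros of \<open>H\<close> the velocity decreases towards
  \<open>- \<mu>\<close>, so \<open>V\<close> can only reach a new height at a zero of \<open>H\<close>, where \<open>V = V - H\<close>.

  Upper bounds.  If \<open>V\<close> climbs from \<open>a\<close> to \<open>a + X\<close>, then over the last such climb \<open>B\<close> must have gained
  \<open>X + \<kappa> a d\<close> in some time \<open>d\<close>.  The probability of this is of order \<open>exp (- 2 \<kappa> a X)\<close> at most, whatever
  \<open>d\<close> is, and there are about \<open>4\<^sup>j\<close> pairs of times to choose from; with \<open>a = X\<close> equal to \<open>\<beta> \<surd>j\<close> the union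
  bound (lemma \<open>increments_below_line\<close>) succeeds as soon as \<open>\<kappa> \<beta>\<^sup>2 > ln 2\<close>, which gives \<open>2 / \<surd>\<kappa>\<close>.  In the
  same way \<open>H\<close> can only reach \<open>X\<close>, up to lower order terms, if \<open>B\<close> has lost at least \<open>X + \<mu> d\<close> in the time \<open>d\<close>
  since the last zero of \<open>H\<close>; this gives \<open>1 / \<mu>\<close>, better than the claimed \<open>16 / \<mu>\<close>.

  Lower bounds.  Since \<open>V > - \<mu>\<close>, a loss of \<open>y + \<mu> d\<close> by \<open>B\<close> in time \<open>d\<close> forces \<open>H \<ge> y\<close>; the cheapest
  duration \<open>d = y / \<mu>\<close> costs \<open>exp (- 2 \<mu> y)\<close>.  A gain of slightly more than \<open>a + \<kappa> a d\<close> by \<open>B\<close> in time \<open>d\<close>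
  forces \<open>V\<close> above \<open>a\<close>, provided that \<open>H\<close> is small at the beginning; the cheapest duration \<open>d = 1 / \<kappa>\<close> costs
  \<open>exp (- 2 \<kappa> a\<^sup>2)\<close>.  A window contains about \<open>2\<^sup>j / j\<close> independent blocks in which to try, so that for all
  large \<open>j\<close> one of the attempts succeeds if the probability of each exceeds \<open>2\<^sup>-\<^sup>j\<close> by an exponential factor
  (lemma \<open>block_events_occur\<close>).  To make \<open>H\<close> small before the attempt to raise \<open>V\<close>, each block starts with
  a stretch of length proportional to \<open>j\<close> on which the increments of \<open>B\<close> are required to stay within a small
  slope; this has probability close to \<open>1\<close>, and by the upper bounds it is long enough for \<open>H\<close> to come
  down (lemma \<open>x_relaxes\<close>).
\<close>

section \<open>Paths of the inert drift process\<close>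

lemma last_time_below:
  fixes f :: "real \<Rightarrow> real"
  assumes "continuous_on {r..t} f" "r \<le> t" "f r \<le> b"
  obtains \<sigma> where "r \<le> \<sigma>" "\<sigma> \<le> t" "f \<sigma> \<le> b" "\<And>u. \<sigma> < u \<Longrightarrow> u \<le> t \<Longrightarrow> b < f u"
proof -
  let ?S = "{u \<in> {r..t}. f u \<le> b}"
  have "closed ?S"
    using assms by (intro continuous_on_closed_Collect_le continuous_intros) auto
  then have "compact ?S"
    by (auto simp: compact_eq_bounded_closed intro: bounded_subset[of "{r..t}"])
  moreover have "?S \<noteq> {}" using assms by auto
  ultimately obtain \<sigma> where \<sigma>: "\<sigma> \<in> ?S" "\<And>u. u \<in> ?S \<Longrightarrow> u \<le> \<sigma>"
    using compact_attains_sup[of ?S] by blast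
  show thesis
  proof (rule that[of \<sigma>])
    show "b < f u" if "\<sigma> < u" "u \<le> t" for u
      using \<sigma>(1) \<sigma>(2)[of u] that by force
  qed (use \<sigma> in auto)
qed

text \<open>
  Here \<open>- \<mu>\<close> is the terminal velocity of a free flight, and \<open>\<kappa>\<close> is the rate at which \<open>v\<close> relaxes while
  \<open>x\<close> is held at the boundary.
\<close>
locale inert_path =
  fixes \<gamma> g h \<nu> \<kappa> \<mu> :: real and b x v l :: "real \<Rightarrow> real"
  assumes \<gamma>_pos: "\<gamma> > 0" and g_pos: "g > 0"
    and \<kappa>_def: "\<kappa> = 1 + \<gamma>" and \<mu>_def: "\<mu> = g / \<gamma>"
    and path: "inert_drift_path \<gamma> g h \<nu> b x v l"
begin

lemma params: "\<kappa> > 1" "\<mu> > 0" "\<gamma> * \<mu> = g"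
  using \<gamma>_pos g_pos by (auto simp: \<kappa>_def \<mu>_def)

lemma cont: "continuous_on {0..} x" "continuous_on {0..} v" "continuous_on {0..} l"
  and x_nonneg: "0 \<le> t \<Longrightarrow> 0 \<le> x t" and v_gt: "0 \<le> t \<Longrightarrow> - \<mu> < v t"
  and l_nonneg: "0 \<le> t \<Longrightarrow> 0 \<le> l t" and l_mono: "mono_on {0..} l"
  and l_int: "0 \<le> t \<Longrightarrow> (LINT u:{0..t}|interval_measure (\<lambda>u. l (max 0 u)). indicator {u. x u = 0} u) = l t"
  and x_eq: "0 \<le> t \<Longrightarrow> x t = h + integral {0..t} v - b t + l t"
  and v_eq: "0 \<le> t \<Longrightarrow> v t = \<nu> - integral {0..t} (\<lambda>u. \<gamma> * v u + g) + l t"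
  using path unfolding inert_drift_path_def inert_state_space_def \<mu>_def by auto

lemma cont_v: "0 \<le> s \<Longrightarrow> continuous_on {s..t} v" and cont_x: "0 \<le> s \<Longrightarrow> continuous_on {s..t} x"
  using cont by (auto intro: continuous_on_subset)

lemma v_integrable: "0 \<le> s \<Longrightarrow> v integrable_on {s..t}"
  by (intro integrable_continuous_real cont_v)

lemma integral_affine:
  assumes "0 \<le> s" "s \<le> t"
  shows "integral {s..t} (\<lambda>u. c * v u + d) = c * integral {s..t} v + d * (t - s)"
  using assms integrable_on_cmult_left[OF v_integrable[of s t], of c]
  by (subst integral_add) auto

lemma integral_diff_v:
  assumes "0 \<le> s" "s \<le> t"
  shows "integral {0..t} v = integral {0..s} v + integral {s..t} v"
  using assms v_integrable[of 0 t] by (simp add: Henstock_Kurzweil_Integration.integral_combine)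

lemma v_incr:
  assumes "0 \<le> s" "s \<le> t"
  shows "v t - v s = - \<gamma> * integral {s..t} v - g * (t - s) + (l t - l s)"
  using assms v_eq[of s] v_eq[of t] integral_affine[of 0 s \<gamma> g] integral_affine[of 0 t \<gamma> g]
    integral_diff_v[OF assms] by (simp add: algebra_simps)

lemma x_incr:
  assumes "0 \<le> s" "s \<le> t"
  shows "x t - x s = integral {s..t} v - (b t - b s) + (l t - l s)"
  using assms x_eq[of s] x_eq[of t] integral_diff_v[OF assms] by (simp add: algebra_simps)

text \<open>
  Subtracting the two equations removes the boundary term, whatever \<^term>\<open>x\<close> does: \<open>v - x\<close> obeys
  an equation driven by \<^term>\<open>b\<close> alone.
\<close>
lemma diff_incr:
  assumes "0 \<le> s" "s \<le> t"
  shows "(v t - x t) - (v s - x s) = (b t - b s) - \<kappa> * integral {s..t} v - g * (t - s)"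
  using v_incr[OF assms] x_incr[OF assms] by (simp add: \<kappa>_def algebra_simps)

lemma integral_v_ge:
  assumes "0 \<le> s" "s \<le> t" and "\<And>u. s < u \<Longrightarrow> u \<le> t \<Longrightarrow> c \<le> v u"
  shows "c * (t - s) \<le> integral {s..t} v"
proof -
  let ?w = "\<lambda>u. if u = s then c else v u"
  have w: "?w integrable_on {s..t}"
    by (rule integrable_spike[OF v_integrable[of s t], of "{s}"]) (use assms in auto)
  have "integral {s..t} (\<lambda>_. c) \<le> integral {s..t} ?w"
    using assms w by (intro integral_le) auto
  also have "\<dots> = integral {s..t} v"
    by (rule integral_spike[of "{s}"]) auto
  finally show ?thesis using assms by (simp add: mult.commute)
qed

lemma integral_v_le:
  assumes "0 \<le> s" "s \<le> t" and "\<And>u. s \<le> u \<Longrightarrow> u \<le> t \<Longrightarrow> v u \<le> c"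
  shows "integral {s..t} v \<le> c * (t - s)"
proof -
  have "integral {s..t} v \<le> integral {s..t} (\<lambda>_. c)"
    using assms v_integrable[of s t] by (intro integral_le) auto
  then show ?thesis using assms by (simp add: mult.commute)
qed

lemma integral_v_gt: "0 \<le> s \<Longrightarrow> s \<le> t \<Longrightarrow> - \<mu> * (t - s) \<le> integral {s..t} v"
  by (rule integral_v_ge) (auto intro: less_imp_le[OF v_gt])

text \<open>
  The whole mass \<^term>\<open>l t\<close> of \<open>dl\<close> on \<open>{0..t}\<close> sits on the zeros of \<^term>\<open>x\<close>, hence an interval
  free of zeros carries none.
\<close>
lemma l_const:
  assumes "0 \<le> s" "s \<le> t" and pos: "\<And>u. s < u \<Longrightarrow> u \<le> t \<Longrightarrow> 0 < x u"
  shows "l t = l s"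
proof (rule antisym)
  let ?F = "\<lambda>u. l (max 0 u)"
  let ?N = "interval_measure ?F"
  let ?Z = "{u\<in>{0..t}. x u = 0}"
  have mono: "?F u \<le> ?F w" if "u \<le> w" for u w
    by (rule mono_onD[OF l_mono]) (use that in auto)
  have contF: "continuous_on UNIV ?F"
    by (rule continuous_on_compose2[OF cont(3)]) (auto intro!: continuous_intros)
  have Icc: "emeasure ?N {0..s} = ennreal (l s - l 0)"
    using emeasure_interval_measure_Icc[of 0 s ?F] mono contF assms(1) by simp
  have "closed ?Z"
    using cont_x[of 0 t] by (intro continuous_closed_preimage_constant) auto
  then have Z: "?Z \<in> sets ?N" by (simp add: borel_closed)
  have "(\<lambda>u. indicator {0..t} u *\<^sub>R indicator {u. x u = 0} u :: real) = indicator ?Z"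
    by (auto simp: indicator_def fun_eq_iff)
  then have "l t = measure ?N ?Z"
    using l_int[of t] assms Z by (simp add: set_lebesgue_integral_def)
  also have "\<dots> \<le> measure ?N {0..s}"
  proof (rule measure_mono_fmeasurable)
    show "?Z \<subseteq> {0..s}"
    proof
      fix u assume "u \<in> ?Z"
      then show "u \<in> {0..s}" using pos[of u] by (cases "s < u") auto
    qed
    show "{0..s} \<in> fmeasurable ?N" using Icc by (intro fmeasurableI) auto
  qed (fact Z)
  also have "\<dots> \<le> l s"
    using Icc l_nonneg[of 0] l_nonneg[of s] mono[of 0 s] assms(1) by (simp add: measure_def)
  finally show "l t \<le> l s" .
  show "l s \<le> l t" using assms(1,2) by (intro mono_onD[OF l_mono]) auto
qed

text \<open>
  Away from the boundary the velocity relaxes towards \<open>- \<mu>\<close>.  As it never gets there, a free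
  flight starting with velocity \<open>v s\<close> can gain at most \<open>(v s + \<mu>) / \<gamma>\<close> over the drift \<open>- \<mu>\<close>.
\<close>
lemma
  assumes "0 \<le> s" "s \<le> t" and pos: "\<And>u. s < u \<Longrightarrow> u \<le> t \<Longrightarrow> 0 < x u"
  shows free_v: "v t \<le> v s"
    and free_x: "x t \<le> x s + (v s + \<mu>) / \<gamma> - \<mu> * (t - s) - (b t - b s)"
proof -
  have l: "l t = l s" by (rule l_const) (use assms in auto)
  have v: "v t - v s = - \<gamma> * integral {s..t} v - g * (t - s)"
    using v_incr[of s t] assms l by simp
  have I: "integral {s..t} v = (v s - v t) / \<gamma> - \<mu> * (t - s)"
  proof -
    have "integral {s..t} v = (v s - v t - g * (t - s)) / \<gamma>"
      using v \<gamma>_pos by (simp add: nonzero_eq_divide_eq algebra_simps)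
    then show ?thesis by (simp add: \<mu>_def diff_divide_distrib)
  qed
  show "v t \<le> v s"
  proof -
    have "0 \<le> (v s - v t) / \<gamma>" using I integral_v_gt[of s t] assms(1,2) by simp
    then show ?thesis using \<gamma>_pos by (simp add: zero_le_divide_iff)
  qed
  have "(v s - v t) / \<gamma> \<le> (v s + \<mu>) / \<gamma>"
    using v_gt[of t] assms(1,2) \<gamma>_pos by (intro divide_right_mono) auto
  then show "x t \<le> x s + (v s + \<mu>) / \<gamma> - \<mu> * (t - s) - (b t - b s)"
    using I x_incr[of s t] assms(1,2) l by simp
qed

lemma last_zero:
  assumes "0 \<le> r" "r \<le> t"
  obtains (none) "\<And>u. r < u \<Longrightarrow> u \<le> t \<Longrightarrow> 0 < x u"
    | (zero) \<rho> where "r \<le> \<rho>" "\<rho> \<le> t" "x \<rho> = 0" "\<And>u. \<rho> < u \<Longrightarrow> u \<le> t \<Longrightarrow> 0 < x u"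
proof (cases "\<exists>q. r \<le> q \<and> q \<le> t \<and> x q = 0")
  case True
  then obtain q where q: "r \<le> q" "q \<le> t" "x q = 0" by auto
  obtain \<rho> where \<rho>: "q \<le> \<rho>" "\<rho> \<le> t" "x \<rho> \<le> 0" "\<And>u. \<rho> < u \<Longrightarrow> u \<le> t \<Longrightarrow> 0 < x u"
    using last_time_below[of q t x 0] cont_x[of q t] q assms by auto
  then show thesis
    using x_nonneg[of \<rho>] q assms by (intro zero[of \<rho>]) auto
next
  case False
  then show thesis using x_nonneg assms
    by (intro none) (metis less_eq_real_def order_trans)
qed

text \<open>
  The velocity only grows at zeros of \<^term>\<open>x\<close>, where it equals \<open>v - x\<close>.  Looking back from such a
  zero to the last time at which the velocity was at most \<open>a\<close>, the friction has meanwhile pulled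
  \<open>v - x\<close> down at rate \<open>\<kappa> a + g\<close> at least, so that \<^term>\<open>b\<close> must have run ahead of that slope.
\<close>
lemma v_upper:
  assumes "0 \<le> r" "r \<le> t" "v r \<le> a"
    and line: "\<And>s u. r \<le> s \<Longrightarrow> s \<le> u \<Longrightarrow> u \<le> t \<Longrightarrow> b u - b s \<le> X + (\<kappa> * a + g) * (u - s)"
  shows "v t \<le> a + X"
proof -
  have X: "0 \<le> X" using line[of r r] assms by simp
  from assms(1,2) show ?thesis
  proof (cases rule: last_zero)
    case none
    then show ?thesis using free_v[of r t] assms X by fastforce
  next
    case (zero \<rho>)
    obtain \<sigma> where \<sigma>: "r \<le> \<sigma>" "\<sigma> \<le> \<rho>" "v \<sigma> \<le> a" "\<And>u. \<sigma> < u \<Longrightarrow> u \<le> \<rho> \<Longrightarrow> a < v u"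
      using last_time_below[of r \<rho> v a] cont_v[of r \<rho>] assms zero by auto
    have "a * (\<rho> - \<sigma>) \<le> integral {\<sigma>..\<rho>} v"
      using \<sigma> assms by (intro integral_v_ge) (auto intro: less_imp_le)
    then have "\<kappa> * (a * (\<rho> - \<sigma>)) \<le> \<kappa> * integral {\<sigma>..\<rho>} v"
      using params by simp
    moreover have "(v \<rho> - x \<rho>) - (v \<sigma> - x \<sigma>) = (b \<rho> - b \<sigma>) - \<kappa> * integral {\<sigma>..\<rho>} v - g * (\<rho> - \<sigma>)"
      using \<sigma> assms by (intro diff_incr) auto
    moreover have "b \<rho> - b \<sigma> \<le> X + (\<kappa> * a + g) * (\<rho> - \<sigma>)"
      using \<sigma> zero assms by (intro line) auto
    moreover have "0 \<le> x \<sigma>" using \<sigma> assms by (intro x_nonneg) auto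
    ultimately have "v \<rho> \<le> a + X"
      using zero \<sigma>(3) by (simp add: algebra_simps)
    moreover have "v t \<le> v \<rho>" using zero assms by (intro free_v) auto
    ultimately show ?thesis by simp
  qed
qed

text \<open>
  Since its last zero \<open>x\<close> has been in free flight, so that it can only have got high by a fall of
  \<^term>\<open>b\<close> against the drift.
\<close>
lemma x_upper:
  assumes "0 \<le> t" and v: "\<And>u. 0 \<le> u \<Longrightarrow> u \<le> t \<Longrightarrow> v u \<le> A"
    and line: "\<And>s. 0 \<le> s \<Longrightarrow> s \<le> t \<Longrightarrow> - (b t - b s) \<le> X + \<mu> * (t - s)"
  shows "x t \<le> x 0 + (A + \<mu>) / \<gamma> + X"
proof -
  have *: "x t \<le> x 0 + (A + \<mu>) / \<gamma> + X"
    if "0 \<le> s" "s \<le> t" "\<And>u. s < u \<Longrightarrow> u \<le> t \<Longrightarrow> 0 < x u" "x s \<le> x 0" for s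
  proof -
    have "(v s + \<mu>) / \<gamma> \<le> (A + \<mu>) / \<gamma>"
      using v[of s] that \<gamma>_pos by (intro divide_right_mono) auto
    then show ?thesis using free_x[OF that(1,2,3)] line[of s] that by auto
  qed
  show ?thesis
    using order.refl assms(1)
  proof (cases rule: last_zero)
    case none then show ?thesis using *[of 0] assms by auto
  next
    case (zero \<rho>) then show ?thesis using *[of \<rho>] x_nonneg[of 0] by auto
  qed
qed

lemma x_lower:
  assumes "0 \<le> s" "s \<le> t"
  shows "- \<mu> * (t - s) - (b t - b s) \<le> x t"
  using x_incr[OF assms] integral_v_gt[OF assms] x_nonneg[of s] assms
    mono_onD[OF l_mono, of s t] by auto

text \<open>
  If the velocity stays below \<open>a\<close>, the friction is bounded, and \<open>v \<ge> v - x\<close> follows \<^term>\<open>b\<close>: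
  a large increment of \<^term>\<open>b\<close> therefore forces the velocity above \<open>a\<close>.
\<close>
lemma v_lower:
  assumes "0 \<le> s" "s \<le> t"
    and big: "a + x s + \<mu> + (\<kappa> * a + g) * (t - s) < b t - b s"
  obtains u where "s \<le> u" "u \<le> t" "a < v u"
proof (rule ccontr)
  assume "\<not> thesis"
  then have v: "v u \<le> a" if "s \<le> u" "u \<le> t" for u
    using that \<open>\<And>u. _ \<Longrightarrow> _ \<Longrightarrow> _ \<Longrightarrow> thesis\<close> by (meson not_le)
  have "\<kappa> * integral {s..t} v \<le> \<kappa> * (a * (t - s))"
    using integral_v_le[of s t a] v assms params by (intro mult_left_mono) auto
  moreover have "v t \<le> a" "0 \<le> x t" "- \<mu> < v s"
    using v[of t] x_nonneg[of t] v_gt[of s] assms by auto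
  ultimately show False
    using diff_incr[of s t] assms by (simp add: algebra_simps)
qed

text \<open>
  On a long stretch on which \<^term>\<open>b\<close> stays below a small slope \<open>c\<close> up to an error \<open>Y\<close>, the process
  forgets how high it was.  The drift brings \<^term>\<open>x\<close> down to \<open>0\<close> at some time in the second half of the
  stretch.  By then gravity has used up the initial velocity, so that the velocity at the last zero of
  \<^term>\<open>x\<close> is at most \<open>Y\<close>, and the final free flight cannot gain more than \<open>(Y + \<mu>) / \<gamma> + Y\<close>.
\<close>
lemma x_relaxes:
  assumes r: "0 \<le> r" "r \<le> s"
    and v: "\<And>u. r \<le> u \<Longrightarrow> u \<le> s \<Longrightarrow> v u \<le> A"
    and x: "\<And>u. r \<le> u \<Longrightarrow> u \<le> s \<Longrightarrow> x u \<le> A'"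
    and line: "\<And>u w. r \<le> u \<Longrightarrow> u \<le> w \<Longrightarrow> w \<le> s \<Longrightarrow> \<bar>b w - b u\<bar> \<le> Y + c * (w - u)"
    and c: "2 * c \<le> g" "2 * c \<le> \<mu>"
    and long: "A + Y < g * (s - r) / 4" "A' + (A + \<mu>) / \<gamma> + Y < \<mu> * (s - r) / 4"
  shows "x s \<le> (Y + \<mu>) / \<gamma> + Y"
proof -
  define m where "m = (r + s) / 2"
  have m: "0 \<le> m" "r \<le> m" "m \<le> s" "s - m = (s - r) / 2" "m - r = (s - r) / 2"
    using r by (auto simp: m_def field_simps)
  have Y: "0 \<le> Y" using line[of r r] r by simp
  have slope: "c * d \<le> g * d / 2" "c * d \<le> \<mu> * d / 2" if "0 \<le> d" for d
    using mult_right_mono[OF c(1) that] mult_right_mono[OF c(2) that] by auto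
  from m(1,3) show ?thesis
  proof (cases rule: last_zero)
    case none
    have "(v m + \<mu>) / \<gamma> \<le> (A + \<mu>) / \<gamma>"
      using v[of m] m \<gamma>_pos by (intro divide_right_mono) auto
    moreover have "x s \<le> x m + (v m + \<mu>) / \<gamma> - \<mu> * (s - m) - (b s - b m)"
      using none m by (intro free_x) auto
    moreover have "x m \<le> A'" "\<bar>b s - b m\<bar> \<le> Y + c * ((s - r) / 2)"
      "c * ((s - r) / 2) \<le> \<mu> * ((s - r) / 2) / 2"
      using x[of m] line[of m s] slope(2)[of "s - m"] m by auto
    moreover have "\<mu> * ((s - r) / 2) / 2 = \<mu> * (s - r) / 4"
      "\<mu> * ((s - r) / 2) = 2 * (\<mu> * (s - r) / 4)" by simp_all
    ultimately have "x s < 0"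
      using long(2) unfolding m(4) by linarith
    then show ?thesis using x_nonneg[of s] r by simp
  next
    case (zero \<rho>)
    \<comment> \<open>While the velocity is positive, gravity beats the slope \<open>c\<close> and drains it at rate \<open>g / 2\<close>.\<close>
    have flow: "v \<rho> \<le> v \<sigma> + Y - g * (\<rho> - \<sigma>) / 2"
      if "r \<le> \<sigma>" "\<sigma> \<le> \<rho>" "\<And>u. \<sigma> < u \<Longrightarrow> u \<le> \<rho> \<Longrightarrow> 0 < v u" for \<sigma>
    proof -
      have "0 * (\<rho> - \<sigma>) \<le> integral {\<sigma>..\<rho>} v"
        using that r by (intro integral_v_ge) (auto intro: less_imp_le)
      then have "0 \<le> \<kappa> * integral {\<sigma>..\<rho>} v"
        using params by simp
      moreover have "0 \<le> x \<sigma>" using that r by (intro x_nonneg) auto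
      ultimately show ?thesis
        using that zero r diff_incr[of \<sigma> \<rho>] line[of \<sigma> \<rho>] slope(1)[of "\<rho> - \<sigma>"] by auto
    qed
    have "v \<rho> \<le> Y"
    proof (cases "\<exists>q. r \<le> q \<and> q \<le> \<rho> \<and> v q \<le> 0")
      case True
      then obtain q where q: "r \<le> q" "q \<le> \<rho>" "v q \<le> 0" by auto
      obtain \<sigma> where \<sigma>: "q \<le> \<sigma>" "\<sigma> \<le> \<rho>" "v \<sigma> \<le> 0" "\<And>u. \<sigma> < u \<Longrightarrow> u \<le> \<rho> \<Longrightarrow> 0 < v u"
        using last_time_below[of q \<rho> v 0] cont_v[of q \<rho>] q r by auto
      have "0 \<le> g * (\<rho> - \<sigma>)" using g_pos \<sigma>(2) by simp
      moreover have "v \<rho> \<le> v \<sigma> + Y - g * (\<rho> - \<sigma>) / 2"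
        by (rule flow) (use \<sigma> q(1) in auto)
      ultimately show ?thesis using \<sigma>(3) by simp
    next
      case False
      have "0 < v u" if "r < u" "u \<le> \<rho>" for u
      proof (rule ccontr)
        assume "\<not> 0 < v u"
        then show False using False that by (metis less_imp_le not_le)
      qed
      then have "v \<rho> \<le> v r + Y - g * (\<rho> - r) / 2"
        using zero(1) m(2) by (intro flow) auto
      moreover have "g * (s - r) / 2 \<le> g * (\<rho> - r)"
        using mult_left_mono[of "m - r" "\<rho> - r" g] zero(1) g_pos m(5) by auto
      ultimately show ?thesis using v[OF order.refl r(2)] long(1) Y by linarith
    qed
    then have "(v \<rho> + \<mu>) / \<gamma> \<le> (Y + \<mu>) / \<gamma>"
      using \<gamma>_pos by (intro divide_right_mono) auto
    moreover have "x s \<le> x \<rho> + (v \<rho> + \<mu>) / \<gamma> - \<mu> * (s - \<rho>) - (b s - b \<rho>)"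
      using zero m by (intro free_x) auto
    moreover have "0 \<le> \<mu> * (s - \<rho>)" using zero params by simp
    moreover have "\<bar>b s - b \<rho>\<bar> \<le> Y + c * (s - \<rho>)"
      using zero(1,2) m(2) by (intro line) auto
    moreover have "c * (s - \<rho>) \<le> \<mu> * (s - \<rho>) / 2"
      using slope(2)[of "s - \<rho>"] zero(2) by simp
    ultimately show ?thesis
      using zero(3) by linarith
  qed
qed

end

section \<open>Gaussian tails, Borel--Cantelli and independent blocks\<close>

context prob_space
begin

text \<open>
  For \<open>y \<ge> x \<ge> 0\<close> one has \<open>y\<^sup>2 \<ge> x\<^sup>2 + (y - x)\<^sup>2\<close>: beyond \<open>x\<close>, the centred density is at most
  \<open>exp (- x\<^sup>2 / 2\<sigma>\<^sup>2)\<close> times the density centred at \<open>x\<close>, which has mass \<open>1\<close>.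
\<close>
lemma normal_tail_le:
  assumes X: "distributed M lborel X (normal_density 0 \<sigma>)" and \<sigma>: "0 < \<sigma>" and x: "0 \<le> x"
  shows "prob {\<omega>\<in>space M. x \<le> X \<omega>} \<le> exp (- x\<^sup>2 / (2 * \<sigma>\<^sup>2))"
proof -
  let ?e = "exp (- x\<^sup>2 / (2 * \<sigma>\<^sup>2))"
  have le: "normal_density 0 \<sigma> y \<le> ?e * normal_density x \<sigma> y" if "x \<le> y" for y
  proof -
    have "0 \<le> 2 * x * (y - x)" using x that by simp
    then have "x\<^sup>2 + (y - x)\<^sup>2 \<le> y\<^sup>2" by (simp add: power2_eq_square algebra_simps)
    then have "- y\<^sup>2 / (2 * \<sigma>\<^sup>2) \<le> - x\<^sup>2 / (2 * \<sigma>\<^sup>2) + - (y - x)\<^sup>2 / (2 * \<sigma>\<^sup>2)"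
      unfolding add_divide_distrib[symmetric] by (intro divide_right_mono) auto
    then have "exp (- y\<^sup>2 / (2 * \<sigma>\<^sup>2)) \<le> ?e * exp (- (y - x)\<^sup>2 / (2 * \<sigma>\<^sup>2))"
      unfolding exp_add[symmetric] by simp
    then show ?thesis
      unfolding normal_density_def
      by (simp add: divide_right_mono)
  qed
  have "emeasure M (X -` {x..} \<inter> space M) = (\<integral>\<^sup>+y. ennreal (normal_density 0 \<sigma> y) * indicator {x..} y \<partial>lborel)"
    using X by (rule distributed_emeasure) simp
  also have "\<dots> \<le> (\<integral>\<^sup>+y. ennreal ?e * ennreal (normal_density x \<sigma> y) \<partial>lborel)"
    unfolding ennreal_mult'[OF exp_ge_zero, symmetric]
    by (intro nn_integral_mono) (use le in \<open>auto simp: indicator_def intro!: ennreal_leI\<close>)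
  also have "\<dots> = ennreal ?e * (\<integral>\<^sup>+y. ennreal (normal_density x \<sigma> y) \<partial>lborel)"
    by (intro nn_integral_cmult) auto
  also have "(\<integral>\<^sup>+y. ennreal (normal_density x \<sigma> y) \<partial>lborel) = 1"
    using \<sigma> by (subst nn_integral_eq_integral) auto
  finally have "emeasure M {\<omega>\<in>space M. x \<le> X \<omega>} \<le> ennreal ?e"
    by (simp add: vimage_def Int_def conj_commute)
  then show ?thesis by (simp add: emeasure_eq_measure)
qed

lemma normal_abs_tail_le:
  assumes X: "distributed M lborel X (normal_density 0 \<sigma>)" and \<sigma>: "0 < \<sigma>" and x: "0 \<le> x"
  shows "prob {\<omega>\<in>space M. x \<le> \<bar>X \<omega>\<bar>} \<le> 2 * exp (- x\<^sup>2 / (2 * \<sigma>\<^sup>2))"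
proof -
  have [measurable]: "X \<in> borel_measurable M"
    using distributed_measurable[OF X] by simp
  have X': "distributed M lborel (\<lambda>\<omega>. - X \<omega>) (normal_density 0 \<sigma>)"
    using normal_density_affine[OF X \<sigma>, of "-1" 0] by simp
  have "prob {\<omega>\<in>space M. x \<le> \<bar>X \<omega>\<bar>} = prob ({\<omega>\<in>space M. x \<le> X \<omega>} \<union> {\<omega>\<in>space M. x \<le> - X \<omega>})"
    by (intro arg_cong[of _ _ prob]) auto
  also have "\<dots> \<le> prob {\<omega>\<in>space M. x \<le> X \<omega>} + prob {\<omega>\<in>space M. x \<le> - X \<omega>}"
    by (intro measure_Un_le) measurable
  finally show ?thesis
    using normal_tail_le[OF X \<sigma> x] normal_tail_le[OF X' \<sigma> x] by simp
qed

text \<open>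
  The tail contains the interval \<open>[x, x + \<sigma>]\<close>, on which the density is at least its value at the
  right end.
\<close>
lemma normal_tail_ge:
  assumes X: "distributed M lborel X (normal_density 0 \<sigma>)" and \<sigma>: "0 < \<sigma>" and x: "0 \<le> x"
  shows "exp (- (x / \<sigma> + 1)\<^sup>2 / 2) / sqrt (2 * pi) \<le> prob {\<omega>\<in>space M. x \<le> X \<omega>}"
proof -
  let ?c = "normal_density 0 \<sigma> (x + \<sigma>)"
  have le: "?c \<le> normal_density 0 \<sigma> y" if "x \<le> y" "y \<le> x + \<sigma>" for y
  proof -
    have "y\<^sup>2 \<le> (x + \<sigma>)\<^sup>2" using x that by (intro power_mono) auto
    then have "- (x + \<sigma>)\<^sup>2 / (2 * \<sigma>\<^sup>2) \<le> - y\<^sup>2 / (2 * \<sigma>\<^sup>2)"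
      by (intro divide_right_mono) auto
    then show ?thesis unfolding normal_density_def by (simp add: divide_right_mono)
  qed
  have "x / \<sigma> + 1 = (x + \<sigma>) / \<sigma>" using \<sigma> by (simp add: add_divide_distrib)
  then have "exp (- (x / \<sigma> + 1)\<^sup>2 / 2) / sqrt (2 * pi) = ?c * \<sigma>"
    using \<sigma> by (simp add: normal_density_def real_sqrt_mult power_divide field_simps)
  also have "ennreal (?c * \<sigma>) = (\<integral>\<^sup>+y. ennreal ?c * indicator {x..x+\<sigma>} y \<partial>lborel)"
    using \<sigma> by (simp add: nn_integral_cmult_indicator ennreal_mult')
  also have "\<dots> \<le> (\<integral>\<^sup>+y. ennreal (normal_density 0 \<sigma> y) * indicator {x..} y \<partial>lborel)"
    by (intro nn_integral_mono) (auto simp: indicator_def intro!: ennreal_leI le)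
  also have "\<dots> = emeasure M (X -` {x..} \<inter> space M)"
    using X by (rule distributed_emeasure[symmetric]) simp
  also have "X -` {x..} \<inter> space M = {\<omega>\<in>space M. x \<le> X \<omega>}" by auto
  finally show ?thesis by (simp add: emeasure_eq_measure)
qed

text \<open>
  The form of the Borel--Cantelli lemma in which all almost sure statements below are obtained.
\<close>
lemma AE_eventually_notin:
  assumes "\<And>j. A j \<in> events" and "\<forall>\<^sub>F j in sequentially. prob (A j) \<le> f j" and "summable f"
  shows "AE \<omega> in M. \<forall>\<^sub>F j in sequentially. \<omega> \<notin> A j"
proof -
  have "summable (\<lambda>j. prob (A j))"
    by (rule summable_comparison_test_ev[OF _ assms(3)])
       (use assms(2) in eventually_elim, simp)
  then have "AE \<omega> in M. \<forall>\<^sub>F j in sequentially. \<omega> \<in> space M - A j"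
    using assms(1) by (intro borel_cantelli_AE1) (auto simp: less_top[symmetric])
  then show ?thesis by (auto elim: eventually_mono)
qed

lemma indep_vars_blocks:
  assumes "indep_vars (\<lambda>_. borel) \<xi> I" "finite L" "L \<noteq> {}" "\<And>n. n \<in> L \<Longrightarrow> J n \<subseteq> I"
    and "disjoint_family_on J L" "\<And>n. n \<in> L \<Longrightarrow> S n \<in> sets (PiM (J n) (\<lambda>_. borel))"
  shows "prob (\<Inter>n\<in>L. {\<omega>\<in>space M. restrict (\<lambda>i. \<xi> i \<omega>) (J n) \<in> S n}) =
    (\<Prod>n\<in>L. prob {\<omega>\<in>space M. restrict (\<lambda>i. \<xi> i \<omega>) (J n) \<in> S n})"
proof -
  have "indep_vars (\<lambda>n. PiM (J n) (\<lambda>_. borel)) (\<lambda>n \<omega>. restrict (\<lambda>i. \<xi> i \<omega>) (J n)) L"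
    using indep_vars_restrict[OF assms(1,4,5)] by simp
  from indep_varsD[OF this assms(3,2) order.refl assms(6)]
  show ?thesis by (simp add: vimage_def Int_def conj_commute)
qed

end

section \<open>Dyadic grids and chaining\<close>

definition dyadic :: "nat \<Rightarrow> nat \<Rightarrow> real" where
  "dyadic q k = real k / 2 ^ q"

definition dyadic_index :: "nat \<Rightarrow> real \<Rightarrow> nat" where
  "dyadic_index q t = nat \<lfloor>t * 2 ^ q\<rfloor>"

lemma dyadic_nonneg [simp]: "0 \<le> dyadic q k"
  by (simp add: dyadic_def)

lemma dyadic_diff: "dyadic q l - dyadic q k = (real l - real k) / 2 ^ q"
  by (simp add: dyadic_def diff_divide_distrib)

lemma dyadic_less_iff [simp]: "dyadic q k < dyadic q l \<longleftrightarrow> k < l"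
  and dyadic_le_iff [simp]: "dyadic q k \<le> dyadic q l \<longleftrightarrow> k \<le> l"
  by (simp_all add: dyadic_def divide_less_cancel divide_le_cancel)

lemma dyadic_index_le: "0 \<le> t \<Longrightarrow> dyadic q (dyadic_index q t) \<le> t"
  and dyadic_index_gt: "0 \<le> t \<Longrightarrow> t < dyadic q (dyadic_index q t) + 1 / 2 ^ q"
proof -
  assume t: "0 \<le> t"
  then have "0 \<le> \<lfloor>t * 2 ^ q\<rfloor>" by simp
  then have *: "real (dyadic_index q t) = of_int \<lfloor>t * 2 ^ q\<rfloor>"
    by (simp add: dyadic_index_def)
  show "dyadic q (dyadic_index q t) \<le> t"
    unfolding dyadic_def * by (simp add: divide_le_eq)
  have "t * 2 ^ q < of_int \<lfloor>t * 2 ^ q\<rfloor> + 1" by linarith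
  then show "t < dyadic q (dyadic_index q t) + 1 / 2 ^ q"
    unfolding dyadic_def * add_divide_distrib[symmetric] by (simp add: less_divide_eq)
qed

lemma dyadic_index_mono: "s \<le> t \<Longrightarrow> dyadic_index q s \<le> dyadic_index q t"
  unfolding dyadic_index_def by (intro nat_mono floor_mono mult_right_mono) auto

lemma dyadic_index_le_iff: "0 \<le> t \<Longrightarrow> k \<le> dyadic_index q t \<longleftrightarrow> dyadic q k \<le> t"
  unfolding dyadic_index_def dyadic_def by (simp add: le_nat_floor le_nat_iff le_floor_iff divide_le_eq)

lemma dyadic_index_Suc:
  assumes "0 \<le> t"
  shows "dyadic_index (Suc q) t = 2 * dyadic_index q t \<or>
    dyadic_index (Suc q) t = 2 * dyadic_index q t + 1"
proof -
  let ?k = "dyadic_index q t"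
  have "dyadic (Suc q) (2 * ?k) \<le> t"
    using dyadic_index_le[OF assms, of q] by (simp add: dyadic_def)
  then have "2 * ?k \<le> dyadic_index (Suc q) t" using assms by (simp add: dyadic_index_le_iff)
  moreover have "\<not> dyadic (Suc q) (2 * ?k + 2) \<le> t"
    using dyadic_index_gt[OF assms, of q] by (simp add: dyadic_def add_divide_distrib)
  then have "\<not> 2 * ?k + 2 \<le> dyadic_index (Suc q) t" using assms by (subst dyadic_index_le_iff)
  ultimately show ?thesis by linarith
qed

text \<open>
  Chaining: a continuous function is controlled between the points of a dyadic grid as soon as its
  increments over the steps of all finer grids decay geometrically, because the dyadic
  approximations of a point take at most one step from each level to the next.
\<close>
lemma chaining:
  fixes f :: "real \<Rightarrow> real"
  assumes cont: "continuous_on {0..} f" and t: "0 \<le> t" "t \<le> T"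
    and step: "\<And>m k. dyadic (q + m) (Suc k) \<le> T \<Longrightarrow>
      \<bar>f (dyadic (q + m) (Suc k)) - f (dyadic (q + m) k)\<bar> \<le> e * (7/8) ^ m"
    and e: "0 \<le> e"
  shows "\<bar>f t - f (dyadic q (dyadic_index q t))\<bar> \<le> 8 * e"
proof -
  define D where "D m = dyadic (q + m) (dyadic_index (q + m) t)" for m
  have D: "D m \<le> t" "t < D m + 1 / 2 ^ (q + m)" "0 \<le> D m" for m
    using dyadic_index_le dyadic_index_gt t by (auto simp: D_def)
  have "\<bar>f (D m) - f (D 0)\<bar> \<le> 8 * e * (1 - (7/8) ^ m)" for m
  proof (induction m)
    case (Suc m)
    let ?k = "dyadic_index (q + m) t"
    have "\<bar>f (D (Suc m)) - f (D m)\<bar> \<le> e * (7/8) ^ Suc m"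
    proof (cases "dyadic_index (Suc (q + m)) t = 2 * ?k")
      case True
      then have "D (Suc m) = D m" by (simp add: D_def dyadic_def)
      then show ?thesis using e by simp
    next
      case False
      then have *: "dyadic_index (Suc (q + m)) t = Suc (2 * ?k)"
        using dyadic_index_Suc[of t "q + m"] t by auto
      have "D (Suc m) = dyadic (q + Suc m) (Suc (2 * ?k))" "D m = dyadic (q + Suc m) (2 * ?k)"
        using * by (simp_all add: D_def dyadic_def)
      then show ?thesis
        using step[of "Suc m" "2 * ?k"] D(1)[of "Suc m"] t by simp
    qed
    then have "\<bar>f (D (Suc m)) - f (D 0)\<bar> \<le> 8 * e * (1 - (7/8) ^ m) + e * (7/8) ^ Suc m"
      using Suc.IH by linarith
    also have "\<dots> \<le> 8 * e * (1 - (7/8) ^ Suc m)"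
      using e by (simp add: algebra_simps)
    finally show ?case .
  qed simp
  then have bound: "\<bar>f (D m) - f (D 0)\<bar> \<le> 8 * e" for m
    by (rule order_trans) (use e in \<open>simp add: mult_left_le\<close>)
  have lim: "D \<longlonglongrightarrow> t"
  proof (rule tendsto_sandwich[of "\<lambda>m. t - 1 / 2 ^ (q + m)" _ _ "\<lambda>_. t"])
    show "(\<lambda>m. t - 1 / 2 ^ (q + m)) \<longlonglongrightarrow> t" by real_asymp
    show "\<forall>\<^sub>F m in sequentially. t - 1 / 2 ^ (q + m) \<le> D m"
      using D(2) by (intro always_eventually allI) (simp add: diff_le_eq less_imp_le)
  qed (use D(1) in auto)
  have "(\<lambda>m. f (D m)) \<longlonglongrightarrow> f t"
    by (rule continuous_on_tendsto_compose[OF cont lim]) (use D t in auto)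
  then have "(\<lambda>m. \<bar>f (D m) - f (D 0)\<bar>) \<longlonglongrightarrow> \<bar>f t - f (D 0)\<bar>" by (intro tendsto_intros)
  then have "\<bar>f t - f (D 0)\<bar> \<le> 8 * e"
    by (rule LIMSEQ_le_const2) (use bound in auto)
  then show ?thesis by (simp add: D_def)
qed

section \<open>Brownian increments below lines\<close>

locale brownian = prob_space M for M :: "'a measure" +
  fixes B :: "real \<Rightarrow> 'a \<Rightarrow> real"
  assumes bm: "standard_brownian_motion M B"
begin

lemma B_measurable: "0 \<le> t \<Longrightarrow> B t \<in> borel_measurable M"
  and B_cont: "AE \<omega> in M. continuous_on {0..} (\<lambda>t. B t \<omega>)"
  and B_incr: "0 \<le> s \<Longrightarrow> s < t \<Longrightarrow>
        distributed M lborel (\<lambda>\<omega>. B t \<omega> - B s \<omega>) (normal_density 0 (sqrt (t - s)))"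
  and B_indep: "0 \<le> \<tau> 0 \<Longrightarrow> mono_on {..n} \<tau> \<Longrightarrow>
        indep_vars (\<lambda>_. borel) (\<lambda>i \<omega>. B (\<tau> (Suc i)) \<omega> - B (\<tau> i) \<omega>) {..<n}"
  using bm unfolding standard_brownian_motion_def by auto

lemma B_dyadic_measurable [measurable]: "B (dyadic q k) \<in> borel_measurable M"
  by (rule B_measurable) simp

lemma incr_tail_le:
  assumes "0 \<le> s" "s < t" "0 \<le> x"
  shows "prob {\<omega>\<in>space M. x \<le> \<bar>B t \<omega> - B s \<omega>\<bar>} \<le> 2 * exp (- x\<^sup>2 / (2 * (t - s)))"
  using normal_abs_tail_le[OF B_incr[OF assms(1,2)] _ assms(3)] assms(2) by simp

lemma incr_tail_ge:
  assumes "0 \<le> s" "s < t" "0 \<le> x" "\<epsilon> = 1 \<or> \<epsilon> = - 1"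
  shows "exp (- (x / sqrt (t - s) + 1)\<^sup>2 / 2) / sqrt (2 * pi)
    \<le> prob {\<omega>\<in>space M. x \<le> \<epsilon> * (B t \<omega> - B s \<omega>)}"
proof -
  have "distributed M lborel (\<lambda>\<omega>. \<epsilon> * (B t \<omega> - B s \<omega>)) (normal_density 0 (sqrt (t - s)))"
    using normal_density_affine[OF B_incr[OF assms(1,2)], of \<epsilon> 0] assms by auto
  from normal_tail_ge[OF this _ assms(3)] assms(2) show ?thesis by simp
qed

text \<open>
  By \<open>(X + c d)\<^sup>2 \<ge> 4 X c d\<close>, the chance that an increment exceeds the line \<open>X + c d\<close> is bounded
  uniformly in its length \<open>d\<close>.
\<close>
lemma line_tail_le:
  assumes "0 \<le> s" "s \<le> t" "0 < X" "0 \<le> c"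
  shows "prob {\<omega>\<in>space M. X + c * (t - s) \<le> \<bar>B t \<omega> - B s \<omega>\<bar>} \<le> 2 * exp (- 2 * X * c)"
proof (cases "s = t")
  case True then show ?thesis using assms by simp
next
  case False
  define d where "d = t - s"
  have d: "0 < d" using False assms by (simp add: d_def)
  have "4 * X * c * d \<le> (X + c * d)\<^sup>2"
    using zero_le_power2[of "X - c * d"] by (simp add: power2_eq_square algebra_simps)
  then have "2 * X * c \<le> (X + c * d)\<^sup>2 / (2 * d)"
    using d by (simp add: le_divide_eq algebra_simps)
  then have *: "2 * exp (- (X + c * d)\<^sup>2 / (2 * d)) \<le> 2 * exp (- 2 * X * c)" by simp
  have "0 \<le> X + c * d" using assms d by simp
  then have "prob {\<omega>\<in>space M. X + c * d \<le> \<bar>B t \<omega> - B s \<omega>\<bar>} \<le> 2 * exp (- (X + c * d)\<^sup>2 / (2 * d))"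
    unfolding d_def by (intro incr_tail_le) (use assms False in auto)
  also note *
  finally show ?thesis by (simp add: d_def)
qed

text \<open>
  The oscillation between grid points of mesh \<open>2\<^sup>-\<^sup>q\<close> up to time \<open>2\<^sup>j\<^sup>+\<^sup>1\<close> is of order \<open>\<surd>j\<close>, like the
  quantities to be estimated, but with a factor that is as small as desired for large \<open>q\<close>.  The
  bounds for the steps of mesh \<open>2\<^sup>-\<^sup>q\<^sup>-\<^sup>m\<close> shrink like \<open>(7/8)\<^sup>m\<close>, hence more slowly than the standard deviations,
  which shrink like \<open>2\<^sup>-\<^sup>m\<^sup>/\<^sup>2\<close>; the union bound over all levels therefore converges.
\<close>
lemma dyadic_oscillation:
  "AE \<omega> in M. \<forall>\<^sub>F j in sequentially. \<forall>t. 0 \<le> t \<and> t \<le> 2 ^ (j + 1) \<longrightarrow>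
     \<bar>B t \<omega> - B (dyadic q (dyadic_index q t)) \<omega>\<bar> \<le> 32 * sqrt j / sqrt (2 ^ q)"
proof -
  define e where "e j = 4 * sqrt (real j) / sqrt (2 ^ q)" for j :: nat
  define bad where "bad j m k = {\<omega>\<in>space M. e j * (7/8) ^ m \<le>
    \<bar>B (dyadic (q + m) (Suc k)) \<omega> - B (dyadic (q + m) k) \<omega>\<bar>}" for j m k
  define Bad where "Bad j m = (\<Union>k<2 ^ (j + 1 + q + m). bad j m k)" for j m
  define S where "S = (\<Sum>m. exp (- 1 :: real) ^ m)"
  have [measurable]: "bad j m k \<in> events" for j m k unfolding bad_def by measurable
  have [measurable]: "Bad j m \<in> events" for j m unfolding Bad_def by auto
  have e_nonneg: "0 \<le> e j" for j by (simp add: e_def)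
  have bad_le: "prob (bad j m k) \<le> 2 * exp (- (8 * real j + 4 * real j * real m))" for j m k
  proof -
    have "prob (bad j m k) \<le> 2 * exp (- (e j * (7/8) ^ m)\<^sup>2 /
        (2 * (dyadic (q + m) (Suc k) - dyadic (q + m) k)))"
      unfolding bad_def by (intro incr_tail_le) (auto simp: e_nonneg)
    also have "- (e j * (7/8) ^ m)\<^sup>2 / (2 * (dyadic (q + m) (Suc k) - dyadic (q + m) k))
        = - (8 * real j * (49/32) ^ m)"
    proof -
      have "((7/8) ^ m)\<^sup>2 * 2 ^ m = (49/32 :: real) ^ m"
        by (simp add: power2_eq_square power_mult_distrib[symmetric])
      then show ?thesis
        by (simp add: e_def dyadic_diff power_mult_distrib power_divide power_add field_simps)
    qed
    also have "2 * exp (- (8 * real j * (49/32) ^ m)) \<le> 2 * exp (- (8 * real j + 4 * real j * real m))"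
    proof -
      have "1 + real m / 2 \<le> 1 + real m * (17/32)" by simp
      also have "\<dots> \<le> (1 + 17/32) ^ m" by (rule Bernoulli_inequality) simp
      finally have "1 + real m / 2 \<le> (49/32) ^ m" by simp
      then have "8 * real j * (1 + real m / 2) \<le> 8 * real j * (49/32) ^ m"
        by (intro mult_left_mono) auto
      then show ?thesis by (simp add: algebra_simps)
    qed
    finally show ?thesis .
  qed
  have Bad_le: "prob (Bad j m) \<le> 2 ^ (q + 2) * exp (- real j) * exp (- 1) ^ m" if "1 \<le> j" for j m
  proof -
    have "prob (Bad j m) \<le> (\<Sum>k<2 ^ (j + 1 + q + m). prob (bad j m k))"
      unfolding Bad_def by (intro measure_UNION_le) auto
    also have "\<dots> \<le> (\<Sum>k<(2 ^ (j + 1 + q + m)::nat). 2 * exp (- (8 * real j + 4 * real j * real m)))"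
      by (intro sum_mono bad_le)
    also have "\<dots> = 2 ^ (q + 2) * (2 ^ (j + m) * exp (- (8 * real j + 4 * real j * real m)))"
      by (simp add: power_add)
    also have "\<dots> \<le> 2 ^ (q + 2) * (exp (real (j + m)) * exp (- (2 * real j + 2 * real m)))"
    proof (intro mult_left_mono mult_mono)
      have "2 ^ (j + m) \<le> exp (1::real) ^ (j + m)"
        using exp_ge_add_one_self[of 1] by (intro power_mono) auto
      then show "2 ^ (j + m) \<le> exp (real (j + m))" by (simp add: exp_of_nat_mult[symmetric])
      have "real m \<le> real j * real m" using mult_right_mono[of 1 "real j" "real m"] that by simp
      then show "exp (- (8 * real j + 4 * real j * real m)) \<le> exp (- (2 * real j + 2 * real m))"
        by simp
    qed auto
    also have "\<dots> = 2 ^ (q + 2) * exp (- real j) * exp (- 1) ^ m"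
      by (simp add: exp_of_nat_mult[symmetric] exp_add[symmetric] mult.assoc)
    finally show ?thesis .
  qed
  have sm: "summable (\<lambda>m. exp (- 1 :: real) ^ m)" by (intro summable_geometric) simp
  have "AE \<omega> in M. \<forall>\<^sub>F j in sequentially. \<omega> \<notin> (\<Union>m. Bad j m)"
  proof (rule AE_eventually_notin)
    show "\<forall>\<^sub>F j in sequentially. prob (\<Union>m. Bad j m) \<le> 2 ^ (q + 2) * S * exp (- 1) ^ j"
      using eventually_ge_at_top[of 1]
    proof eventually_elim
      case (elim j)
      have s2: "summable (\<lambda>m. 2 ^ (q + 2) * exp (- real j) * exp (- 1 :: real) ^ m)"
        using sm by (rule summable_mult)
      have s1: "summable (\<lambda>m. prob (Bad j m))"
        by (rule summable_comparison_test[OF _ s2]) (use Bad_le[OF elim] in auto)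
      have "ennreal (prob (\<Union>m. Bad j m)) \<le> ennreal (\<Sum>m. prob (Bad j m))"
        unfolding emeasure_eq_measure[symmetric]
        using s1 by (intro emeasure_union_summable(2)) (auto simp: less_top[symmetric])
      then have "prob (\<Union>m. Bad j m) \<le> (\<Sum>m. prob (Bad j m))"
        using s1 by (simp add: suminf_nonneg)
      also have "\<dots> \<le> (\<Sum>m. 2 ^ (q + 2) * exp (- real j) * exp (- 1) ^ m)"
        by (intro suminf_le Bad_le elim s1 s2)
      also have "\<dots> = 2 ^ (q + 2) * exp (- real j) * S"
        unfolding S_def by (rule suminf_mult[OF sm])
      finally show ?case by (simp add: exp_of_nat_mult[symmetric] mult_ac)
    qed
    show "summable (\<lambda>j. 2 ^ (q + 2) * S * exp (- 1 :: real) ^ j)"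
      using sm by (rule summable_mult)
  qed auto
  then show ?thesis
    using B_cont AE_space
  proof eventually_elim
    case (elim \<omega>)
    from elim(1) show ?case
    proof eventually_elim
      fix j assume j: "\<omega> \<notin> (\<Union>m. Bad j m)"
      have "\<bar>B (dyadic (q + m) (Suc k)) \<omega> - B (dyadic (q + m) k) \<omega>\<bar> \<le> e j * (7/8) ^ m"
        if "dyadic (q + m) (Suc k) \<le> 2 ^ (j + 1)" for m k
      proof -
        have "real (Suc k) \<le> 2 ^ (j + 1) * 2 ^ (q + m)"
          using that by (simp add: dyadic_def divide_le_eq)
        also have "\<dots> = real (2 ^ (j + 1 + q + m))" by (simp add: power_add)
        finally have "k < 2 ^ (j + 1 + q + m)" unfolding of_nat_le_iff by simp
        then have "\<omega> \<notin> bad j m k" using j by (auto simp: Bad_def)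
        then show ?thesis using elim(3) by (auto simp: bad_def)
      qed
      then show "\<forall>t. 0 \<le> t \<and> t \<le> 2 ^ (j + 1) \<longrightarrow>
          \<bar>B t \<omega> - B (dyadic q (dyadic_index q t)) \<omega>\<bar> \<le> 32 * sqrt j / sqrt (2 ^ q)"
        using chaining[OF elim(2), of _ "2 ^ (j + 1)" q "e j"] e_nonneg by (auto simp: e_def)
    qed
  qed
qed

text \<open>
  Only grid points are compared here, so that the event is decided by finitely many increments; the
  times between them are recovered from the oscillation bound in lemma \<open>off_line_between\<close>.
\<close>
definition off_line :: "nat \<Rightarrow> nat \<Rightarrow> nat \<Rightarrow> real \<Rightarrow> real \<Rightarrow> 'a set" where
  "off_line q a d X c = (\<Union>k\<in>{a..a+d}. \<Union>l\<in>{k..a+d}.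
     {\<omega>\<in>space M. X + c * (dyadic q l - dyadic q k) \<le> \<bar>B (dyadic q l) \<omega> - B (dyadic q k) \<omega>\<bar>})"

lemma off_line_measurable [measurable]: "off_line q a d X c \<in> events"
  unfolding off_line_def by measurable

lemma prob_off_line_le:
  assumes "0 < X" "0 \<le> c"
  shows "prob (off_line q a d X c) \<le> (real d + 1)\<^sup>2 * (2 * exp (- 2 * X * c))"
proof -
  let ?S = "SIGMA k:{a..a+d}. {k..a+d}"
  let ?E = "\<lambda>(k, l). {\<omega>\<in>space M. X + c * (dyadic q l - dyadic q k) \<le> \<bar>B (dyadic q l) \<omega> - B (dyadic q k) \<omega>\<bar>}"
  have "off_line q a d X c = (\<Union>p\<in>?S. ?E p)"
    unfolding off_line_def by auto
  then have "prob (off_line q a d X c) \<le> (\<Sum>p\<in>?S. prob (?E p))"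
    by (simp only:) (rule measure_UNION_le, auto)
  also have "\<dots> \<le> (\<Sum>p\<in>?S. 2 * exp (- 2 * X * c))"
    using line_tail_le[OF dyadic_nonneg _ assms] by (intro sum_mono) auto
  also have "\<dots> = real (card ?S) * (2 * exp (- 2 * X * c))" by simp
  also have "real (card ?S) \<le> real (card ({a..a+d} \<times> {a..a+d}))"
    unfolding of_nat_le_iff by (intro card_mono) auto
  also have "\<dots> = (real d + 1)\<^sup>2"
    by (simp add: power2_eq_square algebra_simps)
  finally show ?thesis by (simp add: mult_right_mono)
qed

lemma off_line_between:
  assumes \<omega>: "\<omega> \<in> space M" "\<omega> \<notin> off_line q a d X c" and c: "0 \<le> c"
    and osc: "\<And>t. dyadic q a \<le> t \<Longrightarrow> t \<le> dyadic q (a + d) \<Longrightarrow>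
      \<bar>B t \<omega> - B (dyadic q (dyadic_index q t)) \<omega>\<bar> \<le> D"
    and st: "dyadic q a \<le> s" "s \<le> t" "t \<le> dyadic q (a + d)"
  shows "\<bar>B t \<omega> - B s \<omega>\<bar> \<le> X + c / 2 ^ q + 2 * D + c * (t - s)"
proof -
  have s: "0 \<le> s" using dyadic_nonneg[of q a] st by linarith
  let ?k = "dyadic_index q s" and ?l = "dyadic_index q t"
  have "?k \<le> ?l" using st by (intro dyadic_index_mono)
  moreover have "a \<le> ?k" using st s by (simp add: dyadic_index_le_iff)
  moreover have "dyadic q ?l \<le> dyadic q (a + d)" using dyadic_index_le[of t q] st s by linarith
  then have "?l \<le> a + d" by simp
  ultimately have "\<bar>B (dyadic q ?l) \<omega> - B (dyadic q ?k) \<omega>\<bar> \<le> X + c * (dyadic q ?l - dyadic q ?k)"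
    using \<omega> by (force simp: off_line_def)
  also have "\<dots> \<le> X + c * ((t - s) + 1 / 2 ^ q)"
    using dyadic_index_le[of t q] dyadic_index_gt[of s q] s st c
    by (intro add_left_mono mult_left_mono) auto
  finally have "\<bar>B (dyadic q ?l) \<omega> - B (dyadic q ?k) \<omega>\<bar> \<le> X + c / 2 ^ q + c * (t - s)"
    by (simp add: algebra_simps)
  then show ?thesis using osc[of s] osc[of t] st by linarith
qed

text \<open>
  If \<open>X c\<close> exceeds \<open>j ln 2\<close> by a fixed factor, the bound for a single pair of times beats the number of pairs of grid
  points below \<open>2\<^sup>j\<^sup>+\<^sup>1\<close>, which is of order \<open>4\<^sup>j\<close>.
\<close>
lemma increments_below_line:
  assumes \<theta>: "ln 2 < \<theta>" and X: "\<And>j. 1 \<le> j \<Longrightarrow> 0 < X j" "\<And>j. 0 \<le> c j"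
    and Xc: "\<And>j. X j * c j = \<theta> * real j"
  shows "AE \<omega> in M. \<forall>\<^sub>F j in sequentially. \<forall>s t. 0 \<le> s \<and> s \<le> t \<and> t \<le> 2 ^ (j + 1) \<longrightarrow>
     \<bar>B t \<omega> - B s \<omega>\<bar> \<le> X j + c j / 2 ^ q + 64 * sqrt j / sqrt (2 ^ q) + c j * (t - s)"
proof -
  have "AE \<omega> in M. \<forall>\<^sub>F j in sequentially. \<omega> \<notin> off_line q 0 (2 ^ (j + 1 + q)) (X j) (c j)"
  proof (rule AE_eventually_notin)
    show "\<forall>\<^sub>F j in sequentially. prob (off_line q 0 (2 ^ (j + 1 + q)) (X j) (c j)) \<le>
      2 ^ (2 * q + 5) * (4 * exp (- 2 * \<theta>)) ^ j"
      using eventually_ge_at_top[of 1]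
    proof eventually_elim
      case (elim j)
      have "prob (off_line q 0 (2 ^ (j + 1 + q)) (X j) (c j)) \<le>
          (real (2 ^ (j + 1 + q)) + 1)\<^sup>2 * (2 * exp (- 2 * X j * c j))"
        using elim X by (intro prob_off_line_le) auto
      also have "\<dots> \<le> (2 ^ (j + 2 + q))\<^sup>2 * (2 * exp (- 2 * \<theta> * real j))"
      proof (intro mult_mono power_mono)
        have "1 \<le> (2::real) ^ (j + 1 + q)" by (rule one_le_power) simp
        then show "real (2 ^ (j + 1 + q)) + 1 \<le> 2 ^ (j + 2 + q)" by simp
      qed (use Xc[of j] in \<open>auto simp: mult.assoc\<close>)
      also have "\<dots> = 2 ^ (2 * q + 5) * (4 * exp (- 2 * \<theta>)) ^ j"
      proof -
        have "((2::real) ^ (j + 2 + q))\<^sup>2 * 2 = 2 ^ (2 * q + 5) * 4 ^ j"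
        proof -
          have "((2::real) ^ (j + 2 + q))\<^sup>2 = 4 ^ (j + 2 + q)"
            by (simp only: power2_eq_square power_mult_distrib[symmetric]) simp
          then show ?thesis by (simp add: power_add power_mult)
        qed
        moreover have "exp (- 2 * \<theta> * real j) = exp (- 2 * \<theta>) ^ j"
          by (simp add: exp_of_nat_mult[symmetric] mult_ac)
        ultimately show ?thesis by (simp add: power_mult_distrib mult_ac)
      qed
      finally show ?case .
    qed
    have "exp (2 * ln 2) < exp (2 * \<theta>)" using \<theta> by simp
    then have "4 < exp (2 * \<theta>)" by (simp add: exp_double)
    then have "4 * exp (- 2 * \<theta>) < 1" by (simp add: exp_minus field_simps)
    then show "summable (\<lambda>j. 2 ^ (2 * q + 5) * (4 * exp (- 2 * \<theta>)) ^ j)"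
      by (intro summable_mult summable_geometric) simp
  qed auto
  then show ?thesis
    using dyadic_oscillation[of q] AE_space
  proof eventually_elim
    case (elim \<omega>)
    from elim(1,2) show ?case
    proof eventually_elim
      case (elim j)
      show ?case
      proof (intro allI impI, elim conjE)
        fix s t :: real
        assume st: "0 \<le> s" "s \<le> t" "t \<le> 2 ^ (j + 1)"
        have top: "dyadic q (0 + 2 ^ (j + 1 + q)) = 2 ^ (j + 1)" and bot: "dyadic q 0 = 0"
          by (simp_all add: dyadic_def power_add)
        have "\<bar>B t \<omega> - B s \<omega>\<bar> \<le> X j + c j / 2 ^ q + 2 * (32 * sqrt j / sqrt (2 ^ q)) + c j * (t - s)"
          by (rule off_line_between[OF \<open>\<omega> \<in> space M\<close> elim(1) X(2)], unfold top bot)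
             (use elim(2) st in auto)
        then show "\<bar>B t \<omega> - B s \<omega>\<bar> \<le> X j + c j / 2 ^ q + 64 * sqrt j / sqrt (2 ^ q) + c j * (t - s)"
          by simp
      qed
    qed
  qed
qed

end

section \<open>Independent attempts\<close>

lemma borel_measurable_sum_components:
  fixes J :: "nat set"
  assumes "A \<subseteq> J"
  shows "(\<lambda>f. \<Sum>i\<in>A. f i :: real) \<in> borel_measurable (PiM J (\<lambda>_. borel))"
  using assms by (intro borel_measurable_sum measurable_component_singleton) auto

context brownian
begin

text \<open>
  A favourable block: a calm stretch of \<open>d\<close> grid steps from index \<open>a\<close>, followed by a push of size
  \<open>y\<close>, upwards for \<open>\<epsilon> = 1\<close> and downwards for \<open>\<epsilon> = - 1\<close>, over the next \<open>m\<close> steps.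
\<close>
definition block_event :: "nat \<Rightarrow> nat \<Rightarrow> nat \<Rightarrow> nat \<Rightarrow> real \<Rightarrow> real \<Rightarrow> real \<Rightarrow> real \<Rightarrow> 'a set" where
  "block_event q a d m X c \<epsilon> y = (space M - off_line q a d X c) \<inter>
     {\<omega>\<in>space M. y \<le> \<epsilon> * (B (dyadic q (a + d + m)) \<omega> - B (dyadic q (a + d)) \<omega>)}"

lemma block_event_measurable [measurable]: "block_event q a d m X c \<epsilon> y \<in> events"
  unfolding block_event_def by measurable

definition step_incr :: "nat \<Rightarrow> nat \<Rightarrow> 'a \<Rightarrow> real" where
  "step_incr q i \<omega> = B (dyadic q (Suc i)) \<omega> - B (dyadic q i) \<omega>"

lemma sum_step_incr: "k \<le> l \<Longrightarrow> (\<Sum>i\<in>{k..<l}. step_incr q i \<omega>) = B (dyadic q l) \<omega> - B (dyadic q k) \<omega>"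
  unfolding step_incr_def by (rule sum_Suc_diff')

lemma indep_step_incr: "indep_vars (\<lambda>_. borel) (step_incr q) {..<N}"
  unfolding step_incr_def[abs_def]
  by (rule B_indep) (auto simp: mono_on_def)

text \<open>
  The complement of \<open>off_line\<close>, expressed through the increments of single grid steps, whose
  independence then transfers to events in disjoint sets of steps.
\<close>
definition calm :: "nat \<Rightarrow> nat \<Rightarrow> nat \<Rightarrow> real \<Rightarrow> real \<Rightarrow> (nat \<Rightarrow> real) \<Rightarrow> bool" where
  "calm q a d X c f \<longleftrightarrow> (\<forall>k\<in>{a..a+d}. \<forall>l\<in>{k..a+d}.
     \<not> X + c * (dyadic q l - dyadic q k) \<le> \<bar>\<Sum>i\<in>{k..<l}. f i\<bar>)"

lemma calm_measurable:
  assumes "{a..<a+d} \<subseteq> J"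
  shows "{f \<in> space (PiM J (\<lambda>_. borel)). calm q a d X c f} \<in> sets (PiM J (\<lambda>_. borel))"
  unfolding calm_def
proof (intro sets.sets_Collect_finite_All sets.sets_Collect_neg)
  fix k l assume "k \<in> {a..a+d}" "l \<in> {k..a+d}"
  then have [measurable]: "(\<lambda>f. \<Sum>i\<in>{k..<l}. f i :: real) \<in> borel_measurable (PiM J (\<lambda>_. borel))"
    using assms by (intro borel_measurable_sum_components) auto
  show "{f \<in> space (PiM J (\<lambda>_. borel)). X + c * (dyadic q l - dyadic q k) \<le> \<bar>\<Sum>i\<in>{k..<l}. f i\<bar>}
      \<in> sets (PiM J (\<lambda>_. borel))" by measurable
qed auto

lemma push_measurable:
  fixes J :: "nat set"
  assumes "A \<subseteq> J"
  shows "{f \<in> space (PiM J (\<lambda>_. borel)). y \<le> \<epsilon> * (\<Sum>i\<in>A. f i :: real)} \<in> sets (PiM J (\<lambda>_. borel))"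
proof -
  have [measurable]: "(\<lambda>f. \<Sum>i\<in>A. f i :: real) \<in> borel_measurable (PiM J (\<lambda>_. borel))"
    using assms by (rule borel_measurable_sum_components)
  show ?thesis by measurable
qed

lemma calm_restrict:
  assumes "{a..<a+d} \<subseteq> J" "\<omega> \<in> space M"
  shows "calm q a d X c (restrict (\<lambda>i. step_incr q i \<omega>) J) \<longleftrightarrow> \<omega> \<notin> off_line q a d X c"
proof -
  have "(\<Sum>i\<in>{k..<l}. restrict (\<lambda>i. step_incr q i \<omega>) J i) = B (dyadic q l) \<omega> - B (dyadic q k) \<omega>"
    if "k \<in> {a..a+d}" "l \<in> {k..a+d}" for k l
  proof -
    have "(\<Sum>i\<in>{k..<l}. restrict (\<lambda>i. step_incr q i \<omega>) J i) = (\<Sum>i\<in>{k..<l}. step_incr q i \<omega>)"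
      using that assms(1) by (intro sum.cong restrict_apply') auto
    then show ?thesis using that by (simp add: sum_step_incr)
  qed
  then show ?thesis using assms(2) unfolding calm_def off_line_def by auto
qed

lemma push_restrict:
  assumes "{b..<b+m} \<subseteq> J"
  shows "(\<Sum>i\<in>{b..<b+m}. restrict (\<lambda>i. step_incr q i \<omega>) J i) =
    B (dyadic q (b + m)) \<omega> - B (dyadic q b) \<omega>"
proof -
  have "(\<Sum>i\<in>{b..<b+m}. restrict (\<lambda>i. step_incr q i \<omega>) J i) = (\<Sum>i\<in>{b..<b+m}. step_incr q i \<omega>)"
    using assms(1) by (intro sum.cong restrict_apply') auto
  then show ?thesis by (simp add: sum_step_incr)
qed

lemma prob_block_event:
  "prob (block_event q a d m X c \<epsilon> y) = prob (space M - off_line q a d X c) *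
     prob {\<omega>\<in>space M. y \<le> \<epsilon> * (B (dyadic q (a + d + m)) \<omega> - B (dyadic q (a + d)) \<omega>)}"
proof -
  define J where "J p = (if p then {a+d..<a+d+m} else {a..<a+d})" for p
  define S where "S p = (if p
    then {f \<in> space (PiM (J p) (\<lambda>_. borel)). y \<le> \<epsilon> * (\<Sum>i\<in>{a+d..<a+d+m}. f i :: real)}
    else {f \<in> space (PiM (J p) (\<lambda>_. borel)). calm q a d X c f})" for p
  define E where "E p = {\<omega>\<in>space M. restrict (\<lambda>i. step_incr q i \<omega>) (J p) \<in> S p}" for p
  have E: "E True = {\<omega>\<in>space M. y \<le> \<epsilon> * (B (dyadic q (a + d + m)) \<omega> - B (dyadic q (a + d)) \<omega>)}"
    "E False = space M - off_line q a d X c"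
    using push_restrict[of "a + d" m "J True" q] calm_restrict[of a d "J False"]
    by (auto simp: E_def S_def J_def space_PiM)
  have "prob (\<Inter>p\<in>UNIV. E p) = (\<Prod>p\<in>UNIV. prob (E p))"
    unfolding E_def
  proof (rule indep_vars_blocks[OF indep_step_incr[of q "a + d + m"]])
    show "S p \<in> sets (PiM (J p) (\<lambda>_. borel))" for p
      using calm_measurable[of a d "J p"] push_measurable[of "{a+d..<a+d+m}" "J p"]
      by (cases p) (auto simp: S_def J_def)
  qed (auto simp: J_def disjoint_family_on_def)
  then show ?thesis
    by (simp add: UNIV_bool E block_event_def Int_commute mult.commute)
qed

text \<open>
  Independence of the blocks turns the probability of no success into a product, and
  \<open>1 - p \<le> exp (- p)\<close>.
\<close>
lemma prob_no_block_event:
  assumes p: "\<And>n. n < K \<Longrightarrow> p \<le> prob (block_event q (a + n * (d + m)) d m X c \<epsilon> y)"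
    and K: "0 < K"
  shows "prob (\<Inter>n<K. space M - block_event q (a + n * (d + m)) d m X c \<epsilon> y) \<le> exp (- real K * p)"
proof -
  define s where "s n = a + n * (d + m)" for n
  define J where "J n = {s n..<s n + (d + m)}" for n
  define S where "S n = {f \<in> space (PiM (J n) (\<lambda>_. borel)).
     \<not> (calm q (s n) d X c f \<and> y \<le> \<epsilon> * (\<Sum>i\<in>{s n+d..<s n+d+m}. f i))}" for n
  have s: "s (Suc n) = s n + (d + m)" for n by (simp add: s_def)
  have s_le: "s k + (d + m) \<le> s n" if "k < n" for k n
    using mult_right_mono[of "Suc k" n "d + m"] that by (simp add: s_def algebra_simps)
  have E: "{\<omega>\<in>space M. restrict (\<lambda>i. step_incr q i \<omega>) (J n) \<in> S n} =
      space M - block_event q (s n) d m X c \<epsilon> y" for n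
    using push_restrict[of "s n + d" m "J n" q] calm_restrict[of "s n" d "J n"]
    by (auto simp: S_def J_def space_PiM block_event_def)
  have "prob (\<Inter>n<K. space M - block_event q (s n) d m X c \<epsilon> y) =
      (\<Prod>n<K. prob (space M - block_event q (s n) d m X c \<epsilon> y))"
    unfolding E[symmetric]
  proof (rule indep_vars_blocks[OF indep_step_incr[of q "s K"]])
    show "J n \<subseteq> {..<s K}" if "n \<in> {..<K}" for n
      using s_le[of n K] that by (auto simp: J_def)
    have "J k \<inter> J n = {}" if "k < n" for k n
      using s_le[OF that] by (auto simp: J_def)
    then show "disjoint_family_on J {..<K}"
      unfolding disjoint_family_on_def by (metis inf_commute nat_neq_iff)
    show "S n \<in> sets (PiM (J n) (\<lambda>_. borel))" for n
      unfolding S_def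
      by (intro sets.sets_Collect_neg sets.sets_Collect_conj calm_measurable push_measurable)
         (auto simp: J_def)
  qed (use K in auto)
  also have "\<dots> \<le> (\<Prod>n<K. exp (- p))"
  proof (intro prod_mono conjI)
    fix n assume "n \<in> {..<K}"
    then have "prob (space M - block_event q (s n) d m X c \<epsilon> y) \<le> 1 - p"
      using p[of n] by (simp add: prob_compl s_def)
    also have "\<dots> \<le> exp (- p)" using exp_ge_add_one_self[of "- p"] by simp
    finally show "prob (space M - block_event q (s n) d m X c \<epsilon> y) \<le> exp (- p)" .
  qed simp
  also have "\<dots> = exp (- real K * p)"
    by (simp add: exp_of_nat_mult[symmetric])
  finally show ?thesis by (simp add: s_def)
qed

text \<open>
  The second half of Borel--Cantelli, one scale at a time.  The blocks that follow \<open>2\<^sup>j\<close> are independent.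
  In each of them the calm stretch has probability at least \<open>1/2\<close>, and the Gaussian tail bounds the push
  from below, so that the last assumption makes the expected number of favourable blocks at least \<open>j\<close>; then
  the probability that there is none is at most \<open>exp (- j)\<close>.
\<close>
lemma block_events_occur:
  fixes d m K :: "nat \<Rightarrow> nat" and X y :: "nat \<Rightarrow> real"
  assumes \<epsilon>: "\<epsilon> = 1 \<or> \<epsilon> = - 1" and c: "0 \<le> c"
    and ev: "\<forall>\<^sub>F j in sequentially. 0 < m j" "\<forall>\<^sub>F j in sequentially. 0 < X j"
      "\<forall>\<^sub>F j in sequentially. 0 \<le> y j"
    and calm: "\<forall>\<^sub>F j in sequentially. (real (d j) + 1)\<^sup>2 * (2 * exp (- 2 * X j * c)) \<le> 1/2"
    and many: "\<forall>\<^sub>F j in sequentially. real j \<le>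
      real (K j) * (exp (- (y j / sqrt (m j / 2 ^ q) + 1)\<^sup>2 / 2) / sqrt (2 * pi) / 2)"
  shows "AE \<omega> in M. \<forall>\<^sub>F j in sequentially. \<exists>n<K j.
    \<omega> \<in> block_event q (2 ^ (j + q) + n * (d j + m j)) (d j) (m j) (X j) c \<epsilon> (y j)"
proof -
  let ?A = "\<lambda>j n. block_event q (2 ^ (j + q) + n * (d j + m j)) (d j) (m j) (X j) c \<epsilon> (y j)"
  let ?N = "\<lambda>j. space M \<inter> (\<Inter>n\<in>{..<K j}. space M - ?A j n)"
  have "AE \<omega> in M. \<forall>\<^sub>F j in sequentially. \<omega> \<notin> ?N j"
  proof (rule AE_eventually_notin)
    show "\<forall>\<^sub>F j in sequentially. prob (?N j) \<le> exp (- 1) ^ j"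
      using ev calm many eventually_gt_at_top[of 0]
    proof eventually_elim
      case (elim j)
      let ?p = "exp (- (y j / sqrt (m j / 2 ^ q) + 1)\<^sup>2 / 2) / sqrt (2 * pi)"
      have K: "0 < K j" using elim(5,6) by (cases "K j = 0") auto
      have "?p / 2 \<le> prob (?A j n)" for n
      proof -
        let ?a = "2 ^ (j + q) + n * (d j + m j)"
        have "prob (off_line q ?a (d j) (X j) c) \<le> 1/2"
          using prob_off_line_le[OF elim(2) c, of q ?a "d j"] elim(4) by simp
        then have G: "1/2 \<le> prob (space M - off_line q ?a (d j) (X j) c)"
          by (simp add: prob_compl)
        have "dyadic q (?a + d j + m j) - dyadic q (?a + d j) = m j / 2 ^ q"
          by (simp add: dyadic_diff)
        then have "?p \<le> prob {\<omega>\<in>space M. y j \<le> \<epsilon> *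
            (B (dyadic q (?a + d j + m j)) \<omega> - B (dyadic q (?a + d j)) \<omega>)}"
          using incr_tail_ge[of "dyadic q (?a + d j)" "dyadic q (?a + d j + m j)" "y j" \<epsilon>] elim(1,3) \<epsilon>
          by simp
        then have "1/2 * ?p \<le> prob (?A j n)"
          unfolding prob_block_event using G by (intro mult_mono) auto
        then show ?thesis by simp
      qed
      then have "prob (\<Inter>n<K j. space M - ?A j n) \<le> exp (- real (K j) * (?p / 2))"
        using K by (intro prob_no_block_event) auto
      also have "\<dots> \<le> exp (- real j)" using elim(5) by simp
      finally have "prob (\<Inter>n<K j. space M - ?A j n) \<le> exp (- 1) ^ j"
        by (simp add: exp_of_nat_mult[symmetric])
      moreover have "?N j = (\<Inter>n<K j. space M - ?A j n)" using K by auto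
      ultimately show ?case by simp
    qed
    show "summable (\<lambda>j. exp (- 1 :: real) ^ j)" by (intro summable_geometric) simp
  qed auto
  then show ?thesis
    using AE_space
  proof eventually_elim
    case (elim \<omega>)
    from elim(1) show ?case
      by (rule eventually_mono) (use elim(2) in \<open>auto simp del: INT_simps split: if_splits\<close>)
  qed
qed

end

text \<open>
  When \<open>\<theta>\<^sup>2 / 2 < ln 2\<close>, the expected number of successes in about \<open>2\<^sup>j / j\<close> trials, each of probability
  \<open>exp (- \<theta>\<^sup>2 j / 2)\<close>, grows exponentially in \<open>j\<close>; a correction of order \<open>\<surd>j\<close> in the exponent does not change
  this.
\<close>
lemma enough_blocks:
  fixes C \<theta> e :: real
  assumes C: "0 < C" and \<theta>: "\<theta>\<^sup>2 / 2 < ln 2"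
  shows "\<forall>\<^sub>F j :: nat in sequentially.
    real j \<le> (2 ^ j / (C * (real j + 1)) - 1) * (exp (- (\<theta> * sqrt j + e)\<^sup>2 / 2) / sqrt (2 * pi) / 2)"
proof -
  define \<delta> where "\<delta> = ln 2 - \<theta>\<^sup>2 / 2"
  have \<delta>: "0 < \<delta>" using \<theta> by (simp add: \<delta>_def)
  have eq: "2 ^ j * exp (- (\<theta> * sqrt j + e)\<^sup>2 / 2) = exp (\<delta> * real j - \<theta> * e * sqrt j - e\<^sup>2 / 2)" for j :: nat
  proof -
    have "(2::real) ^ j = exp (real j * ln 2)" by (simp add: exp_of_nat_mult)
    moreover have "- (\<theta> * sqrt j + e)\<^sup>2 / 2 = - (\<theta>\<^sup>2 / 2 * real j) - \<theta> * e * sqrt j - e\<^sup>2 / 2"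
      by (simp add: power2_sum power_mult_distrib field_simps)
    ultimately show ?thesis
      by (simp add: exp_add[symmetric] \<delta>_def right_diff_distrib mult.commute[of _ "real j"])
  qed
  have "\<forall>\<^sub>F j :: nat in sequentially. real j * (2 * sqrt (2 * pi)) + 1 \<le>
      exp (\<delta> * real j - \<theta> * e * sqrt (real j) - e\<^sup>2 / 2) / (C * (real j + 1))"
    using \<delta> C by real_asymp
  then show ?thesis
  proof eventually_elim
    case (elim j)
    let ?E = "exp (- (\<theta> * sqrt j + e)\<^sup>2 / 2)"
    have "real j * (2 * sqrt (2 * pi)) + 1 \<le> 2 ^ j * ?E / (C * (real j + 1))"
      using elim unfolding eq .
    moreover have "?E \<le> 1" by simp
    moreover have "(2 ^ j / (C * (real j + 1)) - 1) * ?E = 2 ^ j * ?E / (C * (real j + 1)) - ?E"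
      by (simp add: left_diff_distrib)
    ultimately have "real j * (2 * sqrt (2 * pi)) \<le> (2 ^ j / (C * (real j + 1)) - 1) * ?E"
      by linarith
    then show ?case by (simp add: field_simps)
  qed
qed

lemma real_div_ge:
  fixes n m :: nat
  assumes "0 < m" "real m \<le> x"
  shows "real n / x - 1 \<le> real (n div m)"
proof -
  have "n \<le> (n div m + 1) * m"
    using assms(1) dividend_less_div_times[of m n] by (simp add: algebra_simps)
  then have "real n \<le> real ((n div m + 1) * m)" unfolding of_nat_le_iff .
  also have "\<dots> = (real (n div m) + 1) * real m" by (simp only: of_nat_mult of_nat_add of_nat_1)
  also have "\<dots> \<le> (real (n div m) + 1) * x" using assms by (intro mult_left_mono) auto
  finally show ?thesis using assms by (simp add: field_simps)
qed

lemma many_blocks: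
  fixes C \<theta> e :: real and w :: "nat \<Rightarrow> nat" and z :: "nat \<Rightarrow> real"
  assumes C: "0 < C" and \<theta>: "\<theta>\<^sup>2 / 2 < ln 2"
    and w: "\<forall>\<^sub>F j in sequentially. 0 < w j \<and> real (w j) \<le> 2 ^ q * (C * (real j + 1))"
    and z: "\<forall>\<^sub>F j in sequentially. 0 \<le> z j \<and> z j \<le> \<theta> * sqrt j + e"
  shows "\<forall>\<^sub>F j in sequentially. real j \<le>
    real (2 ^ (j + q) div w j) * (exp (- (z j + 1)\<^sup>2 / 2) / sqrt (2 * pi) / 2)"
  using enough_blocks[OF C \<theta>, of "e + 1"] w z
proof eventually_elim
  case (elim j)
  let ?E = "exp (- (\<theta> * sqrt j + (e + 1))\<^sup>2 / 2) / sqrt (2 * pi) / 2"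
  let ?E' = "exp (- (z j + 1)\<^sup>2 / 2) / sqrt (2 * pi) / 2"
  let ?K = "real (2 ^ (j + q) div w j)"
  have "2 ^ j / (C * (real j + 1)) - 1 = real (2 ^ (j + q)) / (2 ^ q * (C * (real j + 1))) - 1"
    by (simp add: power_add)
  also have "\<dots> \<le> ?K" using elim(2) by (intro real_div_ge) auto
  finally have "(2 ^ j / (C * (real j + 1)) - 1) * ?E \<le> ?K * ?E"
    by (intro mult_right_mono) auto
  also have "\<dots> \<le> ?K * ?E'"
  proof -
    have "(z j + 1)\<^sup>2 \<le> (\<theta> * sqrt j + (e + 1))\<^sup>2" using elim(3) by (intro power_mono) auto
    then have "?E \<le> ?E'" by (intro divide_right_mono) auto
    then show ?thesis by (rule mult_left_mono) simp
  qed
  finally show ?case using elim(1) by linarith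
qed

section \<open>Limits along dyadic windows\<close>

lemma eventually_at_top_dyadic:
  fixes P :: "real \<Rightarrow> bool"
  assumes "\<forall>\<^sub>F j :: nat in sequentially. \<forall>t. 2 ^ j \<le> t \<and> t \<le> 2 ^ (j + 1) \<longrightarrow> P t"
  shows "eventually P at_top"
proof -
  obtain J where J: "\<And>j t. J \<le> j \<Longrightarrow> 2 ^ j \<le> t \<Longrightarrow> t \<le> 2 ^ (j + 1) \<Longrightarrow> P t"
    using assms unfolding eventually_sequentially by blast
  show ?thesis
    unfolding eventually_at_top_linorder
  proof (intro exI allI impI)
    fix t :: real assume t: "2 ^ J \<le> t"
    have t0: "1 \<le> t" using t one_le_power[of "2::real" J] by linarith
    define j where "j = nat \<lfloor>log 2 t\<rfloor>"
    have "0 \<le> log 2 t" using t0 by simp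
    then have j: "real j \<le> log 2 t" "log 2 t \<le> real (j + 1)" unfolding j_def by linarith+
    have "real J \<le> log 2 t" using t t0 by (simp add: le_log_iff powr_realpow)
    then have "J \<le> j" unfolding j_def by linarith
    moreover have "2 ^ j \<le> t" using j(1) t0 by (simp add: le_log_iff powr_realpow)
    moreover have "t \<le> 2 powr real (j + 1)" using j(2) t0 by (subst (asm) log_le_iff) auto
    then have "t \<le> 2 ^ (j + 1)" by (subst (asm) powr_realpow) auto
    ultimately show "P t" by (rule J)
  qed
qed

lemma frequently_at_top_dyadic:
  fixes P :: "real \<Rightarrow> bool"
  assumes "\<forall>\<^sub>F j :: nat in sequentially. \<exists>t. 2 ^ j \<le> t \<and> t \<le> 2 ^ (j + 1) \<and> P t"
  shows "frequently P at_top"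
proof -
  obtain J where J: "\<And>j. J \<le> j \<Longrightarrow> \<exists>t. 2 ^ j \<le> t \<and> t \<le> 2 ^ (j + 1) \<and> P t"
    using assms unfolding eventually_sequentially by blast
  show ?thesis
    unfolding frequently_def eventually_at_top_linorder
  proof
    assume "\<exists>N. \<forall>n\<ge>N. \<not> P n"
    then obtain N where N: "\<And>t. N \<le> t \<Longrightarrow> \<not> P t" by blast
    obtain i where i: "N < 2 ^ i" using real_arch_pow[of 2 N] by auto
    obtain t where t: "2 ^ max i J \<le> t" "P t" using J[of "max i J"] by auto
    have "(2::real) ^ i \<le> 2 ^ max i J" by (intro power_increasing) auto
    then show False using N[of t] i t by linarith
  qed
qed

lemma Limsup_le_if_eventually:
  fixes f :: "real \<Rightarrow> real"
  assumes "\<forall>\<^sub>F t in at_top. f t \<le> C"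
  shows "Limsup at_top (\<lambda>t. ereal (f t)) \<le> ereal C"
  by (rule Limsup_bounded) (use assms in simp)

lemma Limsup_ge_if_frequently:
  fixes f :: "real \<Rightarrow> real"
  assumes "\<exists>\<^sub>F t in at_top. C \<le> f t"
  shows "ereal C \<le> Limsup at_top (\<lambda>t. ereal (f t))"
proof (rule ccontr)
  assume "\<not> ?thesis"
  then have "\<forall>\<^sub>F t in at_top. ereal (f t) < ereal C" by (intro Limsup_lessD) simp
  then have "\<forall>\<^sub>F t in at_top. \<not> C \<le> f t" by eventually_elim simp
  then show False using assms by (simp add: frequently_def)
qed

lemma AE_le_all_above:
  fixes f :: "'a \<Rightarrow> ereal" and C :: real
  assumes "\<And>c. C < c \<Longrightarrow> AE \<omega> in M. f \<omega> \<le> ereal c"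
  shows "AE \<omega> in M. f \<omega> \<le> ereal C"
proof -
  have "AE \<omega> in M. \<forall>n::nat. f \<omega> \<le> ereal (C + 1 / real (Suc n))"
    unfolding AE_all_countable by (intro allI assms) simp
  then show ?thesis
  proof eventually_elim
    case (elim \<omega>)
    have "(\<lambda>n. ereal (C + 1 / real (Suc n))) \<longlonglongrightarrow> ereal C"
      unfolding lim_ereal by real_asymp
    then show ?case by (rule LIMSEQ_le_const) (use elim in auto)
  qed
qed

lemma AE_ge_all_below:
  fixes f :: "'a \<Rightarrow> ereal" and C :: real
  assumes "0 < C" and "\<And>c. 0 < c \<Longrightarrow> c < C \<Longrightarrow> AE \<omega> in M. ereal c \<le> f \<omega>"
  shows "AE \<omega> in M. ereal C \<le> f \<omega>"
proof -
  have "AE \<omega> in M. \<forall>n::nat. ereal (C * (1 - 1 / real (n + 2))) \<le> f \<omega>"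
    unfolding AE_all_countable using assms(1) by (intro allI assms(2)) auto
  then show ?thesis
  proof eventually_elim
    case (elim \<omega>)
    have "(\<lambda>n. ereal (C * (1 - 1 / real (n + 2)))) \<longlonglongrightarrow> ereal C"
      unfolding lim_ereal by real_asymp
    then show ?case by (rule LIMSEQ_le_const2) (use elim in auto)
  qed
qed

lemma ln_dyadic_window:
  fixes t :: real
  assumes "2 ^ j \<le> t" "t \<le> 2 ^ (j + 1)"
  shows "real j * ln 2 \<le> ln t" "ln t \<le> real (j + 1) * ln 2"
proof -
  have t: "0 < t" using assms(1) less_le_trans[of 0 "2 ^ j" t] by simp
  have "ln ((2::real) ^ j) \<le> ln t" using assms t by (subst ln_le_cancel_iff) auto
  then show "real j * ln 2 \<le> ln t" by (simp only: ln_realpow zero_less_numeral)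
  have "ln t \<le> ln ((2::real) ^ (j + 1))" using assms t by (subst ln_le_cancel_iff) auto
  then show "ln t \<le> real (j + 1) * ln 2" by (simp only: ln_realpow zero_less_numeral)
qed

section \<open>Upper bounds\<close>

locale inert_process = brownian M B for M :: "'a measure" and B +
  fixes \<gamma> g h \<nu> \<kappa> \<mu> :: real and H V L :: "real \<Rightarrow> 'a \<Rightarrow> real"
  assumes \<gamma>_pos: "\<gamma> > 0" and g_pos: "g > 0" and \<kappa>_def: "\<kappa> = 1 + \<gamma>" and \<mu>_def: "\<mu> = g / \<gamma>"
    and AE_drift_path: "AE \<omega> in M. inert_drift_path \<gamma> g h \<nu>
        (\<lambda>t. B t \<omega>) (\<lambda>t. H t \<omega>) (\<lambda>t. V t \<omega>) (\<lambda>t. L t \<omega>)"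
begin

lemma params: "\<kappa> > 1" "\<mu> > 0"
  using \<gamma>_pos g_pos by (auto simp: \<kappa>_def \<mu>_def)

lemma AE_inert_path: "AE \<omega> in M. inert_path \<gamma> g h \<nu> \<kappa> \<mu>
    (\<lambda>t. B t \<omega>) (\<lambda>t. H t \<omega>) (\<lambda>t. V t \<omega>) (\<lambda>t. L t \<omega>)"
  using AE_drift_path by eventually_elim (simp add: inert_path_def \<gamma>_pos g_pos \<kappa>_def \<mu>_def)

text \<open>
  The velocity is compared with the level \<open>a = \<beta> \<surd>j\<close>.  Above it the friction has slope at least \<open>\<kappa> a\<close>,
  and for \<open>\<kappa> \<beta>\<^sup>2 > ln 2\<close> no increment of \<open>B\<close> up to time \<open>2\<^sup>j\<^sup>+\<^sup>1\<close> exceeds this slope by much more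
  than \<open>\<beta> \<surd>j\<close>, if \<open>j\<close> is large.
\<close>
lemma V_upper:
  assumes A: "2 * sqrt (ln 2 / \<kappa>) < A"
  shows "AE \<omega> in M. \<forall>\<^sub>F j in sequentially. \<forall>t. 0 \<le> t \<and> t \<le> 2 ^ (j + 1) \<longrightarrow> V t \<omega> \<le> A * sqrt j"
proof -
  define \<beta> where "\<beta> = (sqrt (ln 2 / \<kappa>) + A / 2) / 2"
  have \<beta>: "sqrt (ln 2 / \<kappa>) < \<beta>" "2 * \<beta> < A" using A by (auto simp: \<beta>_def)
  have "0 \<le> sqrt (ln 2 / \<kappa>)" using params by simp
  with \<beta> have \<beta>_pos: "0 < \<beta>" by linarith
  have "(sqrt (ln 2 / \<kappa>))\<^sup>2 < \<beta>\<^sup>2" using \<beta> params by (intro power_strict_mono) auto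
  then have "ln 2 < \<kappa> * \<beta>\<^sup>2" using params by (simp add: divide_less_eq mult.commute)
  have "\<exists>q :: nat. 2 * \<beta> + (\<kappa> * \<beta> / 2 ^ q + 64 / sqrt (2 ^ q)) < A"
  proof (rule eventually_happens'[OF sequentially_bot], rule order_tendstoD)
    have "(\<lambda>q::nat. \<kappa> * \<beta> / 2 ^ q) \<longlonglongrightarrow> 0" by real_asymp
    moreover have "(\<lambda>q::nat. 64 / sqrt (2 ^ q)) \<longlonglongrightarrow> 0" by real_asymp
    ultimately have "(\<lambda>q::nat. 2 * \<beta> + (\<kappa> * \<beta> / 2 ^ q + 64 / sqrt (2 ^ q))) \<longlonglongrightarrow> 2 * \<beta> + (0 + 0)"
      by (intro tendsto_intros)
    then show "(\<lambda>q::nat. 2 * \<beta> + (\<kappa> * \<beta> / 2 ^ q + 64 / sqrt (2 ^ q))) \<longlonglongrightarrow> 2 * \<beta>" by simp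
  qed (rule \<beta>)
  then obtain q where q: "2 * \<beta> + (\<kappa> * \<beta> / 2 ^ q + 64 / sqrt (2 ^ q)) \<le> A"
    using less_imp_le by blast
  have "AE \<omega> in M. \<forall>\<^sub>F j in sequentially. \<forall>s t. 0 \<le> s \<and> s \<le> t \<and> t \<le> 2 ^ (j + 1) \<longrightarrow>
     \<bar>B t \<omega> - B s \<omega>\<bar> \<le> \<beta> * sqrt j + \<kappa> * \<beta> * sqrt j / 2 ^ q + 64 * sqrt j / sqrt (2 ^ q) +
       \<kappa> * \<beta> * sqrt j * (t - s)"
    by (rule increments_below_line[OF \<open>ln 2 < \<kappa> * \<beta>\<^sup>2\<close>])
       (use \<beta>_pos params in \<open>auto simp: power2_eq_square mult_ac\<close>)
  with AE_inert_path show ?thesis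
  proof eventually_elim
    case (elim \<omega>)
    interpret inert_path \<gamma> g h \<nu> \<kappa> \<mu> "\<lambda>t. B t \<omega>" "\<lambda>t. H t \<omega>" "\<lambda>t. V t \<omega>" "\<lambda>t. L t \<omega>"
      by (fact elim(1))
    have "\<forall>\<^sub>F j :: nat in sequentially. V 0 \<omega> \<le> \<beta> * sqrt j"
      using \<beta>_pos by real_asymp
    with elim(2) show ?case
    proof eventually_elim
      case (elim j)
      show ?case
      proof (intro allI impI)
        fix t :: real assume t: "0 \<le> t \<and> t \<le> 2 ^ (j + 1)"
        have "V t \<omega> \<le> \<beta> * sqrt j + (\<beta> * sqrt j + \<kappa> * \<beta> * sqrt j / 2 ^ q + 64 * sqrt j / sqrt (2 ^ q))"
        proof (rule v_upper[of 0])
          fix s u :: real assume su: "0 \<le> s" "s \<le> u" "u \<le> t"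
          have "\<kappa> * \<beta> * sqrt j * (u - s) \<le> (\<kappa> * (\<beta> * sqrt j) + g) * (u - s)"
            using su g_pos by (intro mult_right_mono) auto
          moreover have "\<bar>B u \<omega> - B s \<omega>\<bar> \<le> \<beta> * sqrt j + \<kappa> * \<beta> * sqrt j / 2 ^ q +
              64 * sqrt j / sqrt (2 ^ q) + \<kappa> * \<beta> * sqrt j * (u - s)"
            using elim(1) su t by auto
          ultimately show "B u \<omega> - B s \<omega> \<le> \<beta> * sqrt j + \<kappa> * \<beta> * sqrt j / 2 ^ q +
              64 * sqrt j / sqrt (2 ^ q) + (\<kappa> * (\<beta> * sqrt j) + g) * (u - s)"
            by linarith
        qed (use t elim in auto)
        also have "\<dots> = (2 * \<beta> + (\<kappa> * \<beta> / 2 ^ q + 64 / sqrt (2 ^ q))) * sqrt j"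
          by (simp add: algebra_simps)
        also have "\<dots> \<le> A * sqrt j" using q by (intro mult_right_mono) auto
        finally show "V t \<omega> \<le> A * sqrt j" .
      qed
    qed
  qed
qed

text \<open>
  The slope is the constant drift \<open>\<mu>\<close> here, which makes excesses of order \<open>j\<close> the relevant ones; the
  velocity enters only at order \<open>\<surd>j\<close>.
\<close>
lemma H_upper:
  assumes A: "ln 2 / \<mu> < A"
  shows "AE \<omega> in M. \<forall>\<^sub>F j in sequentially. \<forall>t. 0 \<le> t \<and> t \<le> 2 ^ (j + 1) \<longrightarrow> H t \<omega> \<le> A * real j"
proof -
  define \<alpha> where "\<alpha> = (ln 2 / \<mu> + A) / 2"
  have \<alpha>: "ln 2 / \<mu> < \<alpha>" "\<alpha> < A" using A unfolding \<alpha>_def by (simp_all only: less_divide_eq_numeral1 divide_less_eq_numeral1 mult_2_right)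
  have "0 \<le> ln 2 / \<mu>" using params by simp
  with \<alpha> have \<alpha>_pos: "0 < \<alpha>" by linarith
  have "ln 2 < \<alpha> * \<mu>" using \<alpha>(1) params by (simp add: divide_less_eq)
  \<comment> \<open>Any constant for which \<open>V_upper\<close> applies will do.\<close>
  define a where "a = 2 * sqrt (ln 2 / \<kappa>) + 1"
  have "AE \<omega> in M. \<forall>\<^sub>F j in sequentially. \<forall>s t. 0 \<le> s \<and> s \<le> t \<and> t \<le> 2 ^ (j + 1) \<longrightarrow>
     \<bar>B t \<omega> - B s \<omega>\<bar> \<le> \<alpha> * real j + \<mu> / 2 ^ 0 + 64 * sqrt j / sqrt (2 ^ 0) + \<mu> * (t - s)"
    by (rule increments_below_line[OF \<open>ln 2 < \<alpha> * \<mu>\<close>]) (use \<alpha>_pos params in auto)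
  moreover have "AE \<omega> in M. \<forall>\<^sub>F j in sequentially. \<forall>t. 0 \<le> t \<and> t \<le> 2 ^ (j + 1) \<longrightarrow> V t \<omega> \<le> a * sqrt j"
    by (rule V_upper) (simp add: a_def)
  ultimately show ?thesis
    using AE_inert_path
  proof eventually_elim
    case (elim \<omega>)
    interpret inert_path \<gamma> g h \<nu> \<kappa> \<mu> "\<lambda>t. B t \<omega>" "\<lambda>t. H t \<omega>" "\<lambda>t. V t \<omega>" "\<lambda>t. L t \<omega>"
      by (fact elim(3))
    have "\<forall>\<^sub>F j :: nat in sequentially.
        H 0 \<omega> + (a * sqrt j + \<mu>) / \<gamma> + (\<alpha> * real j + \<mu> + 64 * sqrt j) \<le> A * real j"
      using \<alpha>(2) \<gamma>_pos by real_asymp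
    with elim(1,2) show ?case
    proof eventually_elim
      case (elim j)
      show ?case
      proof (intro allI impI)
        fix t :: real assume t: "0 \<le> t \<and> t \<le> 2 ^ (j + 1)"
        have "H t \<omega> \<le> H 0 \<omega> + (a * sqrt j + \<mu>) / \<gamma> + (\<alpha> * real j + \<mu> + 64 * sqrt j)"
        proof (rule x_upper)
          fix s assume s: "0 \<le> s" "s \<le> t"
          then have "\<bar>B t \<omega> - B s \<omega>\<bar> \<le> \<alpha> * real j + \<mu> / 2 ^ 0 + 64 * sqrt j / sqrt (2 ^ 0) + \<mu> * (t - s)"
            using elim(1) t by blast
          then show "- (B t \<omega> - B s \<omega>) \<le> \<alpha> * real j + \<mu> + 64 * sqrt j + \<mu> * (t - s)" by simp
        qed (use t elim(2) in auto)
        then show "H t \<omega> \<le> A * real j" using elim(3) by simp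
      qed
    qed
  qed
qed

section \<open>Lower bounds\<close>

text \<open>
  The loss \<open>y + \<mu> d\<close> of \<open>B\<close> is attempted over the duration \<open>d = y / \<mu>\<close>, rounded up to an integer, which
  minimises \<open>(y + \<mu> d)\<^sup>2 / (2 d)\<close>; the minimum is \<open>2 \<mu> y\<close>.
\<close>
lemma H_lower:
  assumes \<rho>: "0 < \<rho>" "\<rho> < 1"
  shows "AE \<omega> in M. \<forall>\<^sub>F j in sequentially. \<exists>t. 2 ^ j \<le> t \<and> t \<le> 2 ^ (j + 1) \<and>
    \<rho> * (ln 2 / (2 * \<mu>)) * real j \<le> H t \<omega>"
proof -
  define C where "C = \<rho> * (ln 2 / (2 * \<mu>))"
  have C: "0 < C" using \<rho> params by (simp add: C_def)
  define m where "m j = nat \<lceil>C * real j / \<mu>\<rceil>" for j :: nat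
  define y where "y j = C * real j + \<mu> * real (m j)" for j :: nat
  define u where "u = sqrt (C / \<mu>)"
  have u: "0 < u" "u\<^sup>2 = C / \<mu>" using C params by (auto simp: u_def)
  define K where "K j = 2 ^ (j + 0) div (0 + m j)" for j
  have m: "C * real j / \<mu> \<le> real (m j)" "real (m j) \<le> C * real j / \<mu> + 1" for j
  proof -
    have "0 \<le> C * real j / \<mu>" using C params by simp
    then show "C * real j / \<mu> \<le> real (m j)" "real (m j) \<le> C * real j / \<mu> + 1"
      unfolding m_def by linarith+
  qed
  have m_pos: "0 < m j" if "1 \<le> j" for j
  proof -
    have "0 < C * real j / \<mu>" using C params that by simp
    then show ?thesis using m(1)[of j] by (cases "m j = 0") auto
  qed
  \<comment> \<open>The calm stretch is empty; \<open>X = c = 1\<close> is one choice that satisfies the condition on its probability.\<close>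
  have "AE \<omega> in M. \<forall>\<^sub>F j in sequentially. \<exists>n<K j.
      \<omega> \<in> block_event 0 (2 ^ (j + 0) + n * (0 + m j)) 0 (m j) 1 1 (- 1) (y j)"
  proof (rule block_events_occur)
    have "4 * exp (- 2 :: real) \<le> 1"
    proof -
      have "2 * 2 \<le> exp 1 * exp (1::real)" using exp_ge_add_one_self[of 1] by (intro mult_mono) auto
      then show ?thesis by (simp add: exp_minus field_simps flip: exp_add)
    qed
    then show "\<forall>\<^sub>F j in sequentially. (real 0 + 1)\<^sup>2 * (2 * exp (- 2 * 1 * 1)) \<le> 1 / (2::real)"
      by simp
    show "\<forall>\<^sub>F j in sequentially. real j \<le>
      real (K j) * (exp (- (y j / sqrt (m j / 2 ^ 0) + 1)\<^sup>2 / 2) / sqrt (2 * pi) / 2)"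
      unfolding K_def
    proof (rule many_blocks)
      show "0 < C / \<mu> + 1" using C params by (simp add: add_pos_pos)
      have "(2 * \<mu> * u)\<^sup>2 / 2 = \<rho> * ln 2"
        using params u(2) by (simp add: power_mult_distrib C_def field_simps power2_eq_square)
      then show "(2 * \<mu> * u)\<^sup>2 / 2 < ln 2" using \<rho> by simp
      show "\<forall>\<^sub>F j in sequentially. 0 < 0 + m j \<and> real (0 + m j) \<le> 2 ^ 0 * ((C / \<mu> + 1) * (real j + 1))"
        using eventually_ge_at_top[of 1]
      proof eventually_elim
        case (elim j)
        have "0 \<le> C / \<mu>" using C params by simp
        then have "real (m j) \<le> (C / \<mu> + 1) * (real j + 1)"
          using m(2)[of j] by (simp add: algebra_simps)
        then show ?case using m_pos[OF elim] by simp
      qed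
      show "\<forall>\<^sub>F j in sequentially. 0 \<le> y j / sqrt (real (m j) / 2 ^ 0) \<and>
          y j / sqrt (real (m j) / 2 ^ 0) \<le> 2 * \<mu> * u * sqrt j + \<mu> / u"
        using eventually_ge_at_top[of 1]
      proof eventually_elim
        case (elim j)
        define r where "r = u * sqrt j"
        have r: "0 < r" "u \<le> r" "C * real j = \<mu> * r\<^sup>2"
          using u elim params by (auto simp: r_def power_mult_distrib mult_le_cancel_left1)
        have "sqrt (r\<^sup>2) \<le> sqrt (m j)" using m(1)[of j] r(3) params by (intro real_sqrt_le_mono) simp
        then have "r \<le> sqrt (m j)" using r(1) by simp
        have "y j \<le> 2 * \<mu> * r\<^sup>2 + \<mu>"
          using m(2)[of j] r(3) params mult_left_mono[OF m(2)[of j], of \<mu>] by (simp add: y_def field_simps)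
        moreover have "0 \<le> y j" using C params by (simp add: y_def)
        ultimately have "y j / sqrt (m j) \<le> (2 * \<mu> * r\<^sup>2 + \<mu>) / r"
          using r(1) \<open>r \<le> sqrt (m j)\<close> by (intro frac_le) auto
        also have "\<dots> = 2 * \<mu> * r + \<mu> / r" using r(1) by (simp add: add_divide_distrib power2_eq_square)
        also have "\<mu> / r \<le> \<mu> / u" using r u params by (intro divide_left_mono) auto
        finally show ?case using \<open>0 \<le> y j\<close> by (simp add: r_def)
      qed
    qed
    show "\<forall>\<^sub>F j in sequentially. 0 < m j"
      using eventually_ge_at_top[of 1] by eventually_elim (rule m_pos)
    show "\<forall>\<^sub>F j in sequentially. 0 \<le> y j" using C params by (simp add: y_def)
  qed auto
  with AE_inert_path show ?thesis
  proof eventually_elim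
    case (elim \<omega>)
    interpret inert_path \<gamma> g h \<nu> \<kappa> \<mu> "\<lambda>t. B t \<omega>" "\<lambda>t. H t \<omega>" "\<lambda>t. V t \<omega>" "\<lambda>t. L t \<omega>"
      by (fact elim(1))
    from elim(2) show ?case
    proof eventually_elim
      case (elim j)
      then obtain n where n: "n < K j"
        "\<omega> \<in> block_event 0 (2 ^ (j + 0) + n * (0 + m j)) 0 (m j) 1 1 (- 1) (y j)" by blast
      define s t where "s = 2 ^ j + real n * real (m j)" and "t = s + real (m j)"
      have st: "0 \<le> s" "s \<le> t" "2 ^ j \<le> t" by (auto simp: s_def t_def)
      have "Suc n * m j \<le> K j * m j" using n(1) by (intro mult_right_mono) auto
      also have "\<dots> \<le> 2 ^ j" by (simp add: K_def)
      finally have "real (Suc n * m j) \<le> real (2 ^ j)" unfolding of_nat_le_iff .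
      then have "t \<le> 2 ^ (j + 1)" by (simp add: s_def t_def algebra_simps)
      moreover have "y j \<le> - (B t \<omega> - B s \<omega>)"
        using n(2) by (simp add: block_event_def dyadic_def s_def t_def)
      then have "C * real j \<le> H t \<omega>"
        using x_lower[OF st(1,2)] by (simp add: y_def t_def)
      ultimately show ?case using st by (auto simp: C_def)
    qed
  qed
qed

text \<open>
  The push lasts \<open>1 / \<kappa>\<close>, rounded up to the grid, because \<open>(a + \<kappa> a d)\<^sup>2 / (2 d)\<close> is smallest at \<open>d = 1 / \<kappa>\<close>,
  with minimum \<open>2 \<kappa> a\<^sup>2\<close>.  For \<open>a = \<alpha> \<surd>j\<close> the hypothesis on \<open>\<alpha>\<close> leaves some room in the exponent, which
  pays for the errors of size \<open>\<eta> \<surd>j\<close>: the remaining height of \<open>H\<close> after the calm stretch, the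
  oscillation between grid points and the rounding.
\<close>
lemma V_lower:
  assumes \<alpha>: "0 < \<alpha>" "2 * \<kappa> * \<alpha>\<^sup>2 < ln 2"
  shows "AE \<omega> in M. \<forall>\<^sub>F j in sequentially. \<exists>t. 2 ^ j \<le> t \<and> t \<le> 2 ^ (j + 1) \<and> \<alpha> * sqrt j \<le> V t \<omega>"
proof -
  \<comment> \<open>\<open>\<Theta> \<eta> \<surd>j\<close> is the size of the push, up to a constant, when all errors are at most \<open>\<eta> \<surd>j\<close>.\<close>
  define \<Theta> where "\<Theta> \<eta> = \<alpha> * (2 + \<eta>) + 3 * \<eta> / \<gamma> + 3 * \<eta>" for \<eta> :: real
  have "\<exists>n::nat. (sqrt \<kappa> * \<Theta> (1 / real (Suc n)))\<^sup>2 / 2 < ln 2"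
  proof (rule eventually_happens'[OF sequentially_bot], rule order_tendstoD)
    have "(\<lambda>n. 1 / real (Suc n)) \<longlonglongrightarrow> 0" by real_asymp
    then show "(\<lambda>n. (sqrt \<kappa> * \<Theta> (1 / real (Suc n)))\<^sup>2 / 2) \<longlonglongrightarrow> (sqrt \<kappa> * \<Theta> 0)\<^sup>2 / 2"
      unfolding \<Theta>_def using \<gamma>_pos by (intro tendsto_intros) auto
    show "(sqrt \<kappa> * \<Theta> 0)\<^sup>2 / 2 < ln 2"
      using \<alpha> params by (simp add: \<Theta>_def power_mult_distrib mult_ac)
  qed
  then obtain \<eta> where \<eta>: "0 < \<eta>" "(sqrt \<kappa> * \<Theta> \<eta>)\<^sup>2 / 2 < ln 2"
    by (metis divide_pos_pos of_nat_0_less_iff zero_less_Suc zero_less_one)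
  have "\<forall>\<^sub>F q :: nat in sequentially. 64 / sqrt (2 ^ q) \<le> \<eta>" "\<forall>\<^sub>F q :: nat in sequentially. \<kappa> / 2 ^ q \<le> \<eta>"
    using \<eta>(1) params by real_asymp+
  then have "\<forall>\<^sub>F q :: nat in sequentially. 64 / sqrt (2 ^ q) \<le> \<eta> \<and> \<kappa> / 2 ^ q \<le> \<eta>"
    by (rule eventually_conj)
  then obtain q :: nat where q: "64 / sqrt (2 ^ q) \<le> \<eta>" "\<kappa> / 2 ^ q \<le> \<eta>"
    using eventually_happens'[OF sequentially_bot] by blast
  define m where "m = nat \<lceil>2 ^ q / \<kappa>\<rceil>"
  define \<tau> where "\<tau> = real m / 2 ^ q"
  have "0 < 2 ^ q / \<kappa>" using params by simp
  then have m: "2 ^ q / \<kappa> \<le> real m" "real m \<le> 2 ^ q / \<kappa> + 1" "0 < m"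
    unfolding m_def by linarith+
  have \<tau>_ge: "1 / \<kappa> \<le> \<tau>"
    using divide_right_mono[OF m(1), of "2 ^ q"] by (simp add: \<tau>_def)
  have \<tau>_le: "\<tau> \<le> 1 / \<kappa> + 1 / 2 ^ q"
    using divide_right_mono[OF m(2), of "2 ^ q"] by (simp add: \<tau>_def add_divide_distrib)
  have \<kappa>\<tau>: "\<kappa> * \<tau> \<le> 1 + \<eta>"
  proof -
    have "\<kappa> * \<tau> \<le> \<kappa> * (1 / \<kappa> + 1 / 2 ^ q)" using \<tau>_le params by (intro mult_left_mono) auto
    then show ?thesis using q(2) params by (simp add: distrib_left)
  qed
  have \<tau>2: "0 < \<tau>" "\<tau> \<le> 2"
  proof -
    have "1 / \<kappa> \<le> 1" "1 / 2 ^ q \<le> (1::real)" using params by (simp_all add: one_le_power)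
    then show "\<tau> \<le> 2" using \<tau>_le by linarith
    show "0 < \<tau>" using m(3) by (simp add: \<tau>_def)
  qed
  define c where "c = min g \<mu> / 2"
  have c: "0 < c" "2 * c \<le> g" "2 * c \<le> \<mu>" using g_pos params by (auto simp: c_def)
  define A where "A = 2 * sqrt (ln 2 / \<kappa>) + 1"
  define A' where "A' = ln 2 / \<mu> + 1"
  \<comment> \<open>A calm stretch of duration \<open>N j\<close> lets the drift remove the height \<open>A' j\<close> in half of the time.\<close>
  obtain N :: nat where N: "4 * A' / \<mu> < real N" using reals_Archimedean2 by blast
  have A': "A' < \<mu> * real N / 4" using N params by (simp add: field_simps)
  have "0 < A'" using params by (simp add: A'_def add_nonneg_pos)
  then have "0 < 4 * A' / \<mu>" using params by simp
  then have N_pos: "0 < real N" using N by linarith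
  define d where "d j = N * j * 2 ^ q" for j :: nat
  define c0 where "c0 = \<mu> / \<gamma> + \<mu> + 2 * g + 1"
  define y where "y j = \<Theta> \<eta> * sqrt j + c0" for j :: nat
  have \<Theta>_pos: "0 < \<Theta> \<eta>" using \<eta> \<alpha> \<gamma>_pos by (simp add: \<Theta>_def add_pos_pos)
  have c0_pos: "0 < c0" using g_pos params \<gamma>_pos by (simp add: c0_def add_pos_pos)
  have y_nonneg: "0 \<le> y j" for j using \<Theta>_pos c0_pos by (simp add: y_def)
  define K where "K j = 2 ^ (j + q) div (d j + m)" for j
  have "AE \<omega> in M. \<forall>\<^sub>F j in sequentially. \<exists>n<K j.
      \<omega> \<in> block_event q (2 ^ (j + q) + n * (d j + m)) (d j) m (\<eta> * sqrt j) c 1 (y j)"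
  proof (rule block_events_occur)
    have "\<forall>\<^sub>F j in sequentially. (real N * 2 ^ q * real j + 1)\<^sup>2 * (2 * exp (- 2 * (\<eta> * sqrt j) * c)) \<le> 1/2"
      using N_pos \<eta>(1) c(1) by real_asymp
    then show "\<forall>\<^sub>F j in sequentially. (real (d j) + 1)\<^sup>2 * (2 * exp (- 2 * (\<eta> * sqrt j) * c)) \<le> 1/2"
      by (simp add: d_def mult_ac)
    show "\<forall>\<^sub>F j in sequentially. real j \<le>
      real (K j) * (exp (- (y j / sqrt (m / 2 ^ q) + 1)\<^sup>2 / 2) / sqrt (2 * pi) / 2)"
      unfolding K_def
    proof (rule many_blocks[OF _ \<eta>(2)])
      show "0 < real N + 2" by simp
      show "\<forall>\<^sub>F j in sequentially. 0 < d j + m \<and> real (d j + m) \<le> 2 ^ q * ((real N + 2) * (real j + 1))"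
      proof (intro always_eventually allI conjI)
        fix j
        have "real m \<le> 2 * 2 ^ q" using \<tau>2(2) by (simp add: \<tau>_def divide_le_eq)
        moreover have "2 ^ q * ((real N + 2) * (real j + 1)) =
            real N * real j * 2 ^ q + 2 * 2 ^ q + (real N + 2 * real j) * 2 ^ q"
          by (simp add: algebra_simps)
        moreover have "0 \<le> (real N + 2 * real j) * 2 ^ q" by simp
        moreover have "real (d j + m) = real N * real j * 2 ^ q + real m" by (simp add: d_def)
        ultimately show "real (d j + m) \<le> 2 ^ q * ((real N + 2) * (real j + 1))"
          by linarith
      qed (use m(3) in simp)
      show "\<forall>\<^sub>F j in sequentially. 0 \<le> y j / sqrt (real m / 2 ^ q) \<and>
          y j / sqrt (real m / 2 ^ q) \<le> sqrt \<kappa> * \<Theta> \<eta> * sqrt j + sqrt \<kappa> * c0"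
      proof (intro always_eventually allI conjI)
        fix j
        have "y j / sqrt \<tau> \<le> y j / sqrt (1 / \<kappa>)"
          using \<tau>_ge params y_nonneg[of j] \<tau>2 by (intro divide_left_mono real_sqrt_le_mono) auto
        also have "\<dots> = sqrt \<kappa> * y j" by (simp add: real_sqrt_divide)
        finally show "y j / sqrt (real m / 2 ^ q) \<le> sqrt \<kappa> * \<Theta> \<eta> * sqrt j + sqrt \<kappa> * c0"
          by (simp add: \<tau>_def y_def algebra_simps)
      qed (use y_nonneg in simp)
    qed
    show "\<forall>\<^sub>F j in sequentially. 0 < \<eta> * sqrt (real j)"
      using eventually_gt_at_top[of 0] by eventually_elim (use \<eta>(1) in simp)
  qed (use m(3) c(1) y_nonneg in auto)
  moreover have "AE \<omega> in M. \<forall>\<^sub>F j in sequentially. \<forall>t. 0 \<le> t \<and> t \<le> 2 ^ (j + 1) \<longrightarrow> V t \<omega> \<le> A * sqrt j"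
    by (rule V_upper) (simp add: A_def)
  moreover have "AE \<omega> in M. \<forall>\<^sub>F j in sequentially. \<forall>t. 0 \<le> t \<and> t \<le> 2 ^ (j + 1) \<longrightarrow> H t \<omega> \<le> A' * real j"
    by (rule H_upper) (simp add: A'_def)
  ultimately show ?thesis
    using AE_inert_path dyadic_oscillation[of q] AE_space
  proof eventually_elim
    case (elim \<omega>)
    interpret inert_path \<gamma> g h \<nu> \<kappa> \<mu> "\<lambda>t. B t \<omega>" "\<lambda>t. H t \<omega>" "\<lambda>t. V t \<omega>" "\<lambda>t. L t \<omega>"
      by (fact elim(4))
    have "\<forall>\<^sub>F j :: nat in sequentially. \<eta> * sqrt j + c / 2 ^ q + \<eta> * sqrt j \<le> 3 * \<eta> * sqrt j"
      using \<eta>(1) by real_asymp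
    moreover have "\<forall>\<^sub>F j :: nat in sequentially. A * sqrt j + 3 * \<eta> * sqrt j < g * (real N * real j) / 4"
      using N_pos g_pos by real_asymp
    moreover have "\<forall>\<^sub>F j :: nat in sequentially.
        A' * real j + (A * sqrt j + \<mu>) / \<gamma> + 3 * \<eta> * sqrt j < \<mu> * (real N * real j) / 4"
      using A' \<gamma>_pos by real_asymp
    ultimately show ?case
      using elim(1,2,3,5)
    proof eventually_elim
      case (elim j)
      from elim(4) obtain n where n: "n < K j"
        "\<omega> \<in> block_event q (2 ^ (j + q) + n * (d j + m)) (d j) m (\<eta> * sqrt j) c 1 (y j)" by blast
      define a where "a = 2 ^ (j + q) + n * (d j + m)"
      define r s e where "r = dyadic q a" and "s = dyadic q (a + d j)" and "e = dyadic q (a + d j + m)"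
      have rs: "0 \<le> r" "r \<le> s" "s \<le> e" by (auto simp: r_def s_def e_def)
      have sr: "s - r = real N * real j" and es: "e - s = \<tau>"
        by (simp_all add: r_def s_def e_def dyadic_diff d_def \<tau>_def)
      have "dyadic q (2 ^ (j + q)) \<le> s" by (simp add: s_def a_def)
      then have s_ge: "2 ^ j \<le> s" by (simp add: dyadic_def power_add)
      have e_le: "e \<le> 2 ^ (j + 1)"
      proof -
        have "Suc n * (d j + m) \<le> K j * (d j + m)" using n(1) by (intro mult_right_mono) auto
        also have "\<dots> \<le> 2 ^ (j + q)" unfolding K_def by simp
        finally have "a + d j + m \<le> 2 ^ (j + 1 + q)" by (simp add: a_def)
        then have "e \<le> dyadic q (2 ^ (j + 1 + q))" by (simp add: e_def)
        then show ?thesis by (simp add: dyadic_def power_add)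
      qed
      have off: "\<omega> \<notin> off_line q a (d j) (\<eta> * sqrt j) c" and push: "y j \<le> B e \<omega> - B s \<omega>"
        using n(2) by (auto simp: block_event_def a_def e_def s_def)
      have "H s \<omega> \<le> (3 * \<eta> * sqrt j + \<mu>) / \<gamma> + 3 * \<eta> * sqrt j"
      proof (rule x_relaxes[OF rs(1,2)])
        show "V u \<omega> \<le> A * sqrt j" "H u \<omega> \<le> A' * real j" if "r \<le> u" "u \<le> s" for u
          using elim(5,6) that rs e_le by auto
        show "\<bar>B w \<omega> - B u \<omega>\<bar> \<le> 3 * \<eta> * sqrt j + c * (w - u)" if "r \<le> u" "u \<le> w" "w \<le> s" for u w
        proof -
          have "\<bar>B w \<omega> - B u \<omega>\<bar> \<le> \<eta> * sqrt j + c / 2 ^ q + 2 * (32 * sqrt j / sqrt (2 ^ q)) + c * (w - u)"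
            by (rule off_line_between[OF \<open>\<omega> \<in> space M\<close> off less_imp_le[OF c(1)]])
               (use that elim(7) rs e_le in \<open>auto simp flip: r_def s_def\<close>)
          moreover have "64 / sqrt (2 ^ q) * sqrt j \<le> \<eta> * sqrt j" using q(1) by (intro mult_right_mono) auto
          then have "2 * (32 * sqrt j / sqrt (2 ^ q)) \<le> \<eta> * sqrt j" by simp
          ultimately show ?thesis using elim(1) by linarith
        qed
      qed (use c(2,3) elim(2,3) in \<open>auto simp: sr\<close>)
      moreover have "\<alpha> * sqrt j * (\<kappa> * \<tau>) \<le> \<alpha> * sqrt j * (1 + \<eta>)"
        using \<kappa>\<tau> \<alpha>(1) by (intro mult_left_mono) auto
      moreover have "g * \<tau> \<le> g * 2" using \<tau>2(2) g_pos by simp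
      moreover have "y j = \<alpha> * sqrt j + \<alpha> * sqrt j * (1 + \<eta>) + ((3 * \<eta> * sqrt j + \<mu>) / \<gamma> + 3 * \<eta> * sqrt j) + \<mu> + g * 2 + 1"
        by (simp add: y_def \<Theta>_def c0_def algebra_simps add_divide_distrib)
      moreover have "(\<kappa> * (\<alpha> * sqrt j) + g) * (e - s) = \<alpha> * sqrt j * (\<kappa> * \<tau>) + g * \<tau>"
        by (simp add: es algebra_simps)
      ultimately have "\<alpha> * sqrt j + H s \<omega> + \<mu> + (\<kappa> * (\<alpha> * sqrt j) + g) * (e - s) < B e \<omega> - B s \<omega>"
        using push by linarith
      then obtain t where "s \<le> t" "t \<le> e" "\<alpha> * sqrt j < V t \<omega>"
        using v_lower[of s e "\<alpha> * sqrt j"] rs by auto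
      then show ?case using s_ge e_le by (intro exI[of _ t]) auto
    qed
  qed
qed

section \<open>The limits superior\<close>

lemma Limsup_V_le: "AE \<omega> in M. Limsup at_top (\<lambda>t. ereal (V t \<omega> / sqrt (ln t))) \<le> ereal (2 / sqrt \<kappa>)"
proof (rule AE_le_all_above)
  fix c assume c: "2 / sqrt \<kappa> < c"
  have "0 < 2 / sqrt \<kappa>" using params by simp
  then have c_pos: "0 < c" using c by linarith
  have "2 * sqrt (ln 2 / \<kappa>) = 2 / sqrt \<kappa> * sqrt (ln 2)" by (simp add: real_sqrt_divide)
  also have "\<dots> < c * sqrt (ln 2)" using c by (intro mult_strict_right_mono) auto
  finally have "AE \<omega> in M. \<forall>\<^sub>F j in sequentially. \<forall>t. 0 \<le> t \<and> t \<le> 2 ^ (j + 1) \<longrightarrow>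
    V t \<omega> \<le> c * sqrt (ln 2) * sqrt j" by (rule V_upper)
  then show "AE \<omega> in M. Limsup at_top (\<lambda>t. ereal (V t \<omega> / sqrt (ln t))) \<le> ereal c"
  proof eventually_elim
    case (elim \<omega>)
    have "\<forall>\<^sub>F t in at_top. V t \<omega> / sqrt (ln t) \<le> c"
    proof (rule eventually_at_top_dyadic)
      show "\<forall>\<^sub>F j in sequentially. \<forall>t. 2 ^ j \<le> t \<and> t \<le> 2 ^ (j + 1) \<longrightarrow> V t \<omega> / sqrt (ln t) \<le> c"
        using elim eventually_gt_at_top[of 0]
      proof eventually_elim
        case (elim j)
        show ?case
        proof (intro allI impI, elim conjE)
          fix t :: real assume t: "2 ^ j \<le> t" "t \<le> 2 ^ (j + 1)"
          have "0 < real j * ln 2" using elim(2) by simp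
          then have ln_t: "0 < ln t" using ln_dyadic_window(1)[OF t] by linarith
          have "0 \<le> t" using t(1) zero_le_power[of "2::real" j] by linarith
          then have "V t \<omega> \<le> c * (sqrt (ln 2) * sqrt j)" using elim(1) t by (simp add: mult.assoc)
          also have "sqrt (ln 2) * sqrt j = sqrt (real j * ln 2)" by (simp add: real_sqrt_mult mult.commute)
          also have "c * \<dots> \<le> c * sqrt (ln t)"
            using ln_dyadic_window(1)[OF t] c_pos by (intro mult_left_mono real_sqrt_le_mono) auto
          finally show "V t \<omega> / sqrt (ln t) \<le> c" using ln_t by (simp add: divide_le_eq)
        qed
      qed
    qed
    then show ?case by (rule Limsup_le_if_eventually)
  qed
qed

lemma Limsup_V_ge: "AE \<omega> in M. ereal (1 / sqrt (2 * \<kappa>)) \<le> Limsup at_top (\<lambda>t. ereal (V t \<omega> / sqrt (ln t)))"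
proof (rule AE_ge_all_below)
  show C: "0 < 1 / sqrt (2 * \<kappa>)" using params by simp
  fix c assume c: "0 < c" "c < 1 / sqrt (2 * \<kappa>)"
  define \<beta> where "\<beta> = (c + 1 / sqrt (2 * \<kappa>)) / 2"
  have \<beta>: "c < \<beta>" "\<beta> < 1 / sqrt (2 * \<kappa>)" using c unfolding \<beta>_def by simp_all
  define \<alpha> where "\<alpha> = \<beta> * sqrt (ln 2)"
  have "\<beta>\<^sup>2 < (1 / sqrt (2 * \<kappa>))\<^sup>2" using \<beta> c by (intro power_strict_mono) auto
  then have "2 * \<kappa> * \<beta>\<^sup>2 < 1" using params by (simp add: power_divide field_simps)
  then have "2 * \<kappa> * \<alpha>\<^sup>2 < ln 2"
    using mult_strict_right_mono[of "2 * \<kappa> * \<beta>\<^sup>2" 1 "ln 2"] by (simp add: \<alpha>_def power_mult_distrib)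
  moreover have "0 < \<alpha>" using \<beta> c by (simp add: \<alpha>_def)
  ultimately have "AE \<omega> in M. \<forall>\<^sub>F j in sequentially. \<exists>t. 2 ^ j \<le> t \<and> t \<le> 2 ^ (j + 1) \<and> \<alpha> * sqrt j \<le> V t \<omega>"
    by (intro V_lower)
  then show "AE \<omega> in M. ereal c \<le> Limsup at_top (\<lambda>t. ereal (V t \<omega> / sqrt (ln t)))"
  proof eventually_elim
    case (elim \<omega>)
    have "\<forall>\<^sub>F j :: nat in sequentially. c * sqrt (real j + 1) \<le> \<beta> * sqrt j"
      using \<beta>(1) c(1) by real_asymp
    with elim have "\<forall>\<^sub>F j in sequentially. \<exists>t. 2 ^ j \<le> t \<and> t \<le> 2 ^ (j + 1) \<and> c \<le> V t \<omega> / sqrt (ln t)"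
      using eventually_gt_at_top[of 0]
    proof eventually_elim
      case (elim j)
      then obtain t where t: "2 ^ j \<le> t" "t \<le> 2 ^ (j + 1)" "\<alpha> * sqrt j \<le> V t \<omega>" by blast
      have "0 < real j * ln 2" using elim(3) by simp
      then have ln_t: "0 < ln t" using ln_dyadic_window(1)[OF t(1,2)] by linarith
      have "c * sqrt (ln t) \<le> c * sqrt (real (j + 1) * ln 2)"
        using ln_dyadic_window(2)[OF t(1,2)] c by (intro mult_left_mono real_sqrt_le_mono) auto
      also have "\<dots> = c * sqrt (real j + 1) * sqrt (ln 2)" by (simp add: real_sqrt_mult add.commute)
      also have "\<dots> \<le> \<beta> * sqrt j * sqrt (ln 2)" using elim(2) by (intro mult_right_mono) auto
      also have "\<dots> \<le> V t \<omega>" using t(3) by (simp add: \<alpha>_def mult_ac)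
      finally show ?case using t ln_t by (intro exI[of _ t]) (simp add: le_divide_eq)
    qed
    then have "\<exists>\<^sub>F t in at_top. c \<le> V t \<omega> / sqrt (ln t)" by (rule frequently_at_top_dyadic)
    then show ?case by (rule Limsup_ge_if_frequently)
  qed
qed

lemma Limsup_H_le: "AE \<omega> in M. Limsup at_top (\<lambda>t. ereal (H t \<omega> / ln t)) \<le> ereal (1 / \<mu>)"
proof (rule AE_le_all_above)
  fix c assume c: "1 / \<mu> < c"
  have "0 < 1 / \<mu>" using params by simp
  then have c_pos: "0 < c" using c by linarith
  have "ln 2 / \<mu> < c * ln 2" using mult_strict_right_mono[OF c, of "ln 2"] by simp
  then have "AE \<omega> in M. \<forall>\<^sub>F j in sequentially. \<forall>t. 0 \<le> t \<and> t \<le> 2 ^ (j + 1) \<longrightarrow>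
    H t \<omega> \<le> c * ln 2 * real j" by (rule H_upper)
  then show "AE \<omega> in M. Limsup at_top (\<lambda>t. ereal (H t \<omega> / ln t)) \<le> ereal c"
  proof eventually_elim
    case (elim \<omega>)
    have "\<forall>\<^sub>F t in at_top. H t \<omega> / ln t \<le> c"
    proof (rule eventually_at_top_dyadic)
      show "\<forall>\<^sub>F j in sequentially. \<forall>t. 2 ^ j \<le> t \<and> t \<le> 2 ^ (j + 1) \<longrightarrow> H t \<omega> / ln t \<le> c"
        using elim eventually_gt_at_top[of 0]
      proof eventually_elim
        case (elim j)
        show ?case
        proof (intro allI impI, elim conjE)
          fix t :: real assume t: "2 ^ j \<le> t" "t \<le> 2 ^ (j + 1)"
          have "0 < real j * ln 2" using elim(2) by simp
          then have ln_t: "0 < ln t" using ln_dyadic_window(1)[OF t] by linarith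
          have "0 \<le> t" using t(1) zero_le_power[of "2::real" j] by linarith
          then have "H t \<omega> \<le> c * (real j * ln 2)" using elim(1) t by (simp add: mult_ac)
          also have "\<dots> \<le> c * ln t"
            using ln_dyadic_window(1)[OF t] c_pos by (intro mult_left_mono) auto
          finally show "H t \<omega> / ln t \<le> c" using ln_t by (simp add: divide_le_eq)
        qed
      qed
    qed
    then show ?case by (rule Limsup_le_if_eventually)
  qed
qed

lemma Limsup_H_ge: "AE \<omega> in M. ereal (1 / (2 * \<mu>)) \<le> Limsup at_top (\<lambda>t. ereal (H t \<omega> / ln t))"
proof (rule AE_ge_all_below)
  show "0 < 1 / (2 * \<mu>)" using params by simp
  fix c assume c: "0 < c" "c < 1 / (2 * \<mu>)"
  define \<rho> where "\<rho> = (2 * \<mu> * c + 1) / 2"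
  have "2 * \<mu> * c < 1" "0 < 2 * \<mu> * c" using c params by (simp_all add: field_simps)
  then have \<rho>: "2 * \<mu> * c < \<rho>" "0 < \<rho>" "\<rho> < 1" by (simp_all add: \<rho>_def)
  have c\<rho>: "c < \<rho> / (2 * \<mu>)" using \<rho>(1) params by (simp add: field_simps)
  from H_lower[OF \<rho>(2,3)]
  show "AE \<omega> in M. ereal c \<le> Limsup at_top (\<lambda>t. ereal (H t \<omega> / ln t))"
  proof eventually_elim
    case (elim \<omega>)
    have "\<forall>\<^sub>F j :: nat in sequentially. c * (real j + 1) \<le> \<rho> / (2 * \<mu>) * real j"
      using c\<rho> by real_asymp
    with elim have "\<forall>\<^sub>F j in sequentially. \<exists>t. 2 ^ j \<le> t \<and> t \<le> 2 ^ (j + 1) \<and> c \<le> H t \<omega> / ln t"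
      using eventually_gt_at_top[of 0]
    proof eventually_elim
      case (elim j)
      then obtain t where t: "2 ^ j \<le> t" "t \<le> 2 ^ (j + 1)"
        "\<rho> * (ln 2 / (2 * \<mu>)) * real j \<le> H t \<omega>" by blast
      have "0 < real j * ln 2" using elim(3) by simp
      then have ln_t: "0 < ln t" using ln_dyadic_window(1)[OF t(1,2)] by linarith
      have "c * ln t \<le> c * (real (j + 1) * ln 2)"
        using ln_dyadic_window(2)[OF t(1,2)] c by (intro mult_left_mono) auto
      also have "\<dots> = c * (real j + 1) * ln 2" by (simp add: add.commute)
      also have "\<dots> \<le> \<rho> / (2 * \<mu>) * real j * ln 2" using elim(2) by (intro mult_right_mono) auto
      also have "\<dots> \<le> H t \<omega>" using t(3) by (simp add: mult_ac)
      finally show ?case using t ln_t by (intro exI[of _ t]) (simp add: le_divide_eq)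
    qed
    then have "\<exists>\<^sub>F t in at_top. c \<le> H t \<omega> / ln t" by (rule frequently_at_top_dyadic)
    then show ?case by (rule Limsup_ge_if_frequently)
  qed
qed

end

theorem theorem1p4:
  fixes M :: "'a measure" and \<gamma> g h \<nu> :: real and B H V L :: "real \<Rightarrow> 'a \<Rightarrow> real"
  assumes "\<gamma> > 0" and "g > 0"
    and "(h, \<nu>) \<in> inert_state_space \<gamma> g"
    and "inert_drift_process M \<gamma> g h \<nu> B H V L"
  shows "AE \<omega> in M.
      ereal (1 / (sqrt 2 * sqrt (1 + \<gamma>))) \<le> Limsup at_top (\<lambda>t::real. ereal (V t \<omega> / sqrt (ln t))) \<and>
      Limsup at_top (\<lambda>t::real. ereal (V t \<omega> / sqrt (ln t))) \<le> ereal (2 * (1 / sqrt (1 + \<gamma>))) \<and>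
      ereal (\<gamma> / (2 * g)) \<le> Limsup at_top (\<lambda>t::real. ereal (H t \<omega> / ln t)) \<and>
      Limsup at_top (\<lambda>t::real. ereal (H t \<omega> / ln t)) \<le> ereal (16 * (\<gamma> / g))"
proof -
  have bm: "standard_brownian_motion M B"
    and path: "AE \<omega> in M. inert_drift_path \<gamma> g h \<nu> (\<lambda>t. B t \<omega>) (\<lambda>t. H t \<omega>) (\<lambda>t. V t \<omega>) (\<lambda>t. L t \<omega>)"
    using assms(4) by (auto simp: inert_drift_process_def)
  interpret prob_space M
    using bm by (simp add: standard_brownian_motion_def)
  interpret inert_process M B \<gamma> g h \<nu> "1 + \<gamma>" "g / \<gamma>" H V L
    by unfold_locales (use bm path assms(1,2) in auto)
  have "0 < \<gamma> / g" using assms(1,2) by simp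
  then have "1 / (g / \<gamma>) \<le> 16 * (\<gamma> / g)" by simp
  from Limsup_V_ge Limsup_V_le Limsup_H_ge Limsup_H_le
  show ?thesis
  proof eventually_elim
    case (elim \<omega>)
    have "Limsup at_top (\<lambda>t. ereal (H t \<omega> / ln t)) \<le> ereal (16 * (\<gamma> / g))"
      by (rule order_trans[OF elim(4)]) (use \<open>1 / (g / \<gamma>) \<le> _\<close> in simp)
    moreover have "1 / sqrt (2 * (1 + \<gamma>)) = 1 / (sqrt 2 * sqrt (1 + \<gamma>))"
      by (simp only: real_sqrt_mult)
    moreover have "1 / (2 * (g / \<gamma>)) = \<gamma> / (2 * g)" by simp
    ultimately show ?case using elim(1,2,3) by simp
  qed
qed

end
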